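(* Let $F$ be a field and let $\Gamma$ be a finite simplicial graph. Let $V=H^1(A(\Gamma),F)$, let $W=H^2(A(\Gamma),F)$, and let $q\colon V\times V\to W$ be the cup product pairing. Then the triple $(V,W,q)$ determines $\Gamma$ up to isomorphism. That is, if $\Gamma$ and $\Gamma'$ are finite simplicial graphs whose associated triples $(V,W,q)$ and $(V',W',q')$ (over the same field $F$) are isomorphic as triples, then $\Gamma\cong\Gamma'$ as graphs.
   Context: For a finite simplicial graph $\Gamma$ (undirected, no loops, no multiple edges) with vertex set $V(\Gamma)$ and edge set $E(\Gamma)$, the right-angled Artin group on $\Gamma$ is $A(\Gamma)=\langle V(\Gamma)\mid [v,w]=1 \text{ for all } \{v,w\}\in E(\Gamma)\rangle$. Group cohomology is taken with trivial (untwisted) coefficients in $F$. The triple $(V,W,q)$ is considered abstractly, i.e. as a pair of $F$-vector spaces with a $W$-valued bilinear pairing on $V$, without any further data such as bases. An isomorphism of triples $(V,W,q)\to(V',W',q')$ is a pair of $F$-linear isomorphisms $\phi\colon V\to V'$, $\psi\colon W\to W'$ such that $q'(\phi(x),\phi(y))=\psi(q(x,y))$ for all $x,y\in V$. *)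

theory Defs
  imports "HOL-Algebra.AbelCoset" "HOL-Algebra.Module"
begin

definition simplicial_graph :: "'v set \<Rightarrow> 'v set set \<Rightarrow> bool" where
  "simplicial_graph V E \<longleftrightarrow> finite V \<and> E \<subseteq> {{v, w} |v w. v \<in> V \<and> w \<in> V \<and> v \<noteq> w}"

definition graph_isomorphic :: "'v set \<Rightarrow> 'v set set \<Rightarrow> 'w set \<Rightarrow> 'w set set \<Rightarrow> bool" where
  "graph_isomorphic V E V' E' \<longleftrightarrow>
     (\<exists>f. bij_betw f V V' \<and> (\<forall>v\<in>V. \<forall>w\<in>V. {v, w} \<in> E \<longleftrightarrow> {f v, f w} \<in> E'))"

text \<open>
  A word over \<open>S\<close> is a list of pairs; \<open>(s, True)\<close> stands for the generator \<open>s\<close> and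
  \<open>(s, False)\<close> for its formal inverse. The relation below is the least congruence on the
  monoid of words that cancels adjacent inverse letters and kills the relators in \<open>R\<close>, so the
  quotient is the group with presentation \<open>\<langle>S | R\<rangle>\<close>. The relators are meant to be words over \<open>S\<close>.
\<close>

type_synonym 's word = "('s \<times> bool) list"

abbreviation words :: "'s set \<Rightarrow> 's word set" where
  "words S \<equiv> lists (S \<times> UNIV)"

inductive_set pres_rel :: "'s set \<Rightarrow> 's word set \<Rightarrow> ('s word \<times> 's word) set"
  for S :: "'s set" and R :: "'s word set" where
  refl: "u \<in> words S \<Longrightarrow> (u, u) \<in> pres_rel S R"
| sym: "(u, v) \<in> pres_rel S R \<Longrightarrow> (v, u) \<in> pres_rel S R"
| trans: "(u, v) \<in> pres_rel S R \<Longrightarrow> (v, w) \<in> pres_rel S R \<Longrightarrow> (u, w) \<in> pres_rel S R"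
| cancel: "u \<in> words S \<Longrightarrow> v \<in> words S \<Longrightarrow> s \<in> S \<Longrightarrow>
    (u @ [(s, b), (s, \<not> b)] @ v, u @ v) \<in> pres_rel S R"
| relator: "u \<in> words S \<Longrightarrow> v \<in> words S \<Longrightarrow> r \<in> R \<Longrightarrow> (u @ r @ v, u @ v) \<in> pres_rel S R"

definition presented_group :: "'s set \<Rightarrow> 's word set \<Rightarrow> 's word set monoid" where
  "presented_group S R =
     \<lparr>carrier = words S // pres_rel S R,
      monoid.mult = (\<lambda>A B. \<Union>u\<in>A. \<Union>v\<in>B. pres_rel S R `` {u @ v}),
      one = pres_rel S R `` {[]}\<rparr>"

definition RAAG :: "'v set \<Rightarrow> 'v set set \<Rightarrow> 'v word set monoid" where
  "RAAG V E = presented_group V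
     {[(v, True), (w, True), (v, False), (w, False)] |v w. {v, w} \<in> E}"

text \<open>
  Group cohomology with trivial coefficients in a field \<open>F\<close>, computed by the inhomogeneous
  bar complex: an \<open>n\<close>-cochain is a function
  \<open>G\<^sup>n \<rightarrow> F\<close>, encoded as a function on lists that vanishes on every list other than those of
  length \<open>n\<close> with entries in \<open>G\<close>.
\<close>

definition cochains :: "('g, 'm) monoid_scheme \<Rightarrow> nat \<Rightarrow> ('g list \<Rightarrow> 'f::field) set" where
  "cochains G n = {f. \<forall>gs. \<not> (length gs = n \<and> set gs \<subseteq> carrier G) \<longrightarrow> f gs = 0}"

text \<open>
  \<open>(\<delta>f)(g\<^sub>0,\<dots>,g\<^sub>n) = f(g\<^sub>1,\<dots>,g\<^sub>n) + \<Sum>\<^sub>i\<^sub><\<^sub>n (-1)\<^sup>i\<^sup>+\<^sup>1 f(g\<^sub>0,\<dots>,g\<^sub>i g\<^sub>i\<^sub>+\<^sub>1,\<dots>,g\<^sub>n) + (-1)\<^sup>n\<^sup>+\<^sup>1 f(g\<^sub>0,\<dots>,g\<^sub>n\<^sub>-\<^sub>1)\<close>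
\<close>

definition coboundary ::
    "('g, 'm) monoid_scheme \<Rightarrow> nat \<Rightarrow> ('g list \<Rightarrow> 'f::field) \<Rightarrow> 'g list \<Rightarrow> 'f" where
  "coboundary G n f = (\<lambda>gs.
     if length gs = n + 1 \<and> set gs \<subseteq> carrier G
     then f (tl gs)
        + (\<Sum>i<n. (-1) ^ (i + 1) * f (take i gs @ [gs ! i \<otimes>\<^bsub>G\<^esub> gs ! (i + 1)] @ drop (i + 2) gs))
        + (-1) ^ (n + 1) * f (butlast gs)
     else 0)"

definition cocycles :: "('g, 'm) monoid_scheme \<Rightarrow> nat \<Rightarrow> ('g list \<Rightarrow> 'f::field) set" where
  "cocycles G n = {f \<in> cochains G n. coboundary G n f = (\<lambda>_. 0)}"

definition coboundaries :: "('g, 'm) monoid_scheme \<Rightarrow> nat \<Rightarrow> ('g list \<Rightarrow> 'f::field) set" where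
  "coboundaries G n =
     (case n of 0 \<Rightarrow> {\<lambda>_. 0} | Suc m \<Rightarrow> coboundary G m ` cochains G m)"

text \<open>
  A vector space over the field given by the type \<open>'f\<close> is represented by a HOL-Algebra module
  record with scalars in \<open>'f\<close>, whose \<open>mult\<close> and \<open>one\<close> fields carry no information.
\<close>

definition cocycle_space ::
    "('g, 'm) monoid_scheme \<Rightarrow> nat \<Rightarrow> ('f::field, 'g list \<Rightarrow> 'f) module" where
  "cocycle_space G n =
     \<lparr>carrier = cocycles G n, monoid.mult = undefined, one = undefined,
      zero = (\<lambda>_. 0), add = (\<lambda>f g gs. f gs + g gs), smult = (\<lambda>c f gs. c * f gs)\<rparr>"

definition cohomology_class ::
    "('g, 'm) monoid_scheme \<Rightarrow> nat \<Rightarrow> ('g list \<Rightarrow> 'f::field) \<Rightarrow> ('g list \<Rightarrow> 'f) set" where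
  "cohomology_class G n f = coboundaries G n +>\<^bsub>cocycle_space G n\<^esub> f"

text \<open>
  \<open>H\<^sup>n = Z\<^sup>n / B\<^sup>n\<close>. The unions over representatives here and in \<open>cup\<close> are unions of equal
  cosets.
\<close>

definition cohomology ::
    "('g, 'm) monoid_scheme \<Rightarrow> nat \<Rightarrow> ('f::field, ('g list \<Rightarrow> 'f) set) module" where
  "cohomology G n =
     \<lparr>carrier = a_rcosets\<^bsub>cocycle_space G n\<^esub> (coboundaries G n),
      monoid.mult = undefined, one = undefined,
      zero = coboundaries G n,
      add = (\<lambda>A B. A <+>\<^bsub>cocycle_space G n\<^esub> B),
      smult = (\<lambda>c A. \<Union>f\<in>A. cohomology_class G n (c \<odot>\<^bsub>cocycle_space G n\<^esub> f))\<rparr>"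

definition cup_cochain ::
    "nat \<Rightarrow> ('g list \<Rightarrow> 'f::field) \<Rightarrow> ('g list \<Rightarrow> 'f) \<Rightarrow> 'g list \<Rightarrow> 'f" where
  "cup_cochain p f g = (\<lambda>gs. f (take p gs) * g (drop p gs))"

definition cup ::
    "('g, 'm) monoid_scheme \<Rightarrow> nat \<Rightarrow> nat \<Rightarrow>
     ('g list \<Rightarrow> 'f::field) set \<Rightarrow> ('g list \<Rightarrow> 'f) set \<Rightarrow> ('g list \<Rightarrow> 'f) set" where
  "cup G p q A B = (\<Union>f\<in>A. \<Union>g\<in>B. cohomology_class G (p + q) (cup_cochain p f g))"

definition linear_iso :: "('f::field, 'a) module \<Rightarrow> ('f, 'b) module \<Rightarrow> ('a \<Rightarrow> 'b) \<Rightarrow> bool" where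
  "linear_iso V V' \<phi> \<longleftrightarrow>
     bij_betw \<phi> (carrier V) (carrier V') \<and>
     (\<forall>x\<in>carrier V. \<forall>y\<in>carrier V. \<phi> (x \<oplus>\<^bsub>V\<^esub> y) = \<phi> x \<oplus>\<^bsub>V'\<^esub> \<phi> y) \<and>
     (\<forall>c. \<forall>x\<in>carrier V. \<phi> (c \<odot>\<^bsub>V\<^esub> x) = c \<odot>\<^bsub>V'\<^esub> \<phi> x)"

type_synonym ('f, 'a, 'b) triple = "('f, 'a) module \<times> ('f, 'b) module \<times> ('a \<Rightarrow> 'a \<Rightarrow> 'b)"

fun triple_isomorphic :: "('f::field, 'a, 'b) triple \<Rightarrow> ('f, 'c, 'd) triple \<Rightarrow> bool" where
  "triple_isomorphic (V, W, q) (V', W', q') \<longleftrightarrow>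
     (\<exists>\<phi> \<psi>. linear_iso V V' \<phi> \<and> linear_iso W W' \<psi> \<and>
        (\<forall>x\<in>carrier V. \<forall>y\<in>carrier V. q' (\<phi> x) (\<phi> y) = \<psi> (q x y)))"

definition cup_triple ::
    "'f::field itself \<Rightarrow> ('g, 'm) monoid_scheme \<Rightarrow>
     ('f, ('g list \<Rightarrow> 'f) set, ('g list \<Rightarrow> 'f) set) triple" where
  "cup_triple F G = (cohomology G 1, cohomology G 2, cup G 1 1)"

end

theory Submission
  imports Defs
begin

text \<open>
  A class in \<open>H\<^sup>1\<close> of a right-angled Artin group is a homomorphism to the field, that is, a vector
  \<open>x\<close> of values \<open>x v\<close> on the vertices. The cup product of two such vectors vanishes if and only if
  \<open>x v * y w = x w * y v\<close> for every edge \<open>{v, w}\<close>, which is \<open>cup_zero_iff\<close>: a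
  primitive of the cup product is the corner entry of a representation by Heisenberg matrices, and
  the equation says that the images of adjacent generators commute. An isomorphism of triples
  therefore provides two mutually inverse matrices \<open>X\<close> and \<open>Y\<close>, indexed by the vertices of the
  two graphs, such that the rows of two nonadjacent vertices have vanishing \<open>2 \<times> 2\<close> minors at all
  edges of the other graph. It remains to recover the graph isomorphism from these matrices by
  linear algebra.

  Call the number of nonneighbours of a vertex its level, and call two vectors orthogonal if their
  minors at all edges vanish. If \<open>X v a \<noteq> 0\<close>, every vector orthogonal to the row \<open>X v\<close> is the sum
  of a multiple of that row and a vector supported on the nonneighbours of \<open>a\<close>. Since \<open>v\<close> and its
  nonneighbours have independent rows orthogonal to \<open>X v\<close>, the level of \<open>a\<close> is at least the level
  of \<open>v\<close> (\<open>nonneighbours_card_le\<close>). When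
  the levels agree, every vector supported on the nonneighbours of \<open>a\<close> is orthogonal to \<open>X v\<close>, so
  no nonneighbour of \<open>a\<close> has a neighbour in the support of \<open>X v\<close>
  (\<open>support_avoids_neighbours\<close>).

  As \<open>X\<close> is invertible, there is a bijection \<open>\<sigma>\<close> of the vertices with \<open>X v (\<sigma> v) \<noteq> 0\<close> for all
  \<open>v\<close>. It does not lower levels; comparing with the same fact for \<open>Y\<close>, it preserves them. The two
  facts on levels then imply that \<open>\<sigma>\<close> maps nonadjacent vertices to nonadjacent vertices
  (\<open>transversal_nonadjacent\<close>), and because \<open>\<sigma> v\<close> has as many nonneighbours as \<open>v\<close>,
  it is an isomorphism of graphs.
\<close>

section \<open>Linearly independent rows\<close>

definition independent_rows :: "'a set \<Rightarrow> 'b set \<Rightarrow> ('a \<Rightarrow> 'b \<Rightarrow> 'f::field) \<Rightarrow> bool" where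
  "independent_rows A B x \<longleftrightarrow>
     (\<forall>c. (\<forall>b\<in>B. (\<Sum>v\<in>A. c v * x v b) = 0) \<longrightarrow> (\<forall>v\<in>A. c v = 0))"

lemma independent_rows_subset:
  assumes "independent_rows A B x" "A' \<subseteq> A" "finite A"
  shows "independent_rows A' B x"
  unfolding independent_rows_def
proof (intro allI impI)
  fix c assume c: "\<forall>b\<in>B. (\<Sum>v\<in>A'. c v * x v b) = 0"
  define c' where "c' = (\<lambda>v. if v \<in> A' then c v else 0)"
  have "(\<Sum>v\<in>A. c' v * x v b) = (\<Sum>v\<in>A'. c v * x v b)" for b
    unfolding c'_def using assms(2,3) by (intro sum.mono_neutral_cong_right) auto
  with c assms(1) have "\<forall>v\<in>A. c' v = 0" unfolding independent_rows_def by metis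
  then show "\<forall>v\<in>A'. c v = 0" using assms(2) unfolding c'_def by (metis subsetD)
qed

text \<open>
  Deleting the coordinate \<open>t\<close> can only destroy independence if some nonzero combination of the
  rows is concentrated at \<open>t\<close>; scaled, it is the unit vector at \<open>t\<close>.
\<close>
lemma unit_row_in_span:
  fixes x :: "'a \<Rightarrow> 'b \<Rightarrow> 'f::field"
  assumes "independent_rows A B x" "\<not> independent_rows A (B - {t}) x"
  shows "\<exists>c. \<forall>b\<in>B. (\<Sum>v\<in>A. c v * x v b) = (if b = t then 1 else 0)"
proof -
  obtain c where c: "\<forall>b\<in>B - {t}. (\<Sum>v\<in>A. c v * x v b) = 0" and nz: "\<exists>v\<in>A. c v \<noteq> 0"
    using assms(2) unfolding independent_rows_def by blast
  define k where "k = (\<Sum>v\<in>A. c v * x v t)"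
  have "k \<noteq> 0"
    using assms(1) c nz unfolding independent_rows_def k_def by (metis Diff_iff singletonD)
  moreover have "(\<Sum>v\<in>A. (c v / k) * x v b) = (\<Sum>v\<in>A. c v * x v b) / k" for b
    by (simp add: sum_divide_distrib)
  ultimately have "\<forall>b\<in>B. (\<Sum>v\<in>A. (c v / k) * x v b) = (if b = t then 1 else 0)"
    using c by (auto simp: k_def)
  then show ?thesis by (rule exI[of _ "\<lambda>v. c v / k"])
qed

text \<open>
  Over a square index set this says that a nonzero determinant has a nonzero term in its Leibniz
  expansion. In the induction, the new row \<open>v\<close> needs a coordinate \<open>b\<close> of its support whose
  deletion leaves the other rows independent. If there were none, every unit vector in the support
  of the row \<open>v\<close>, and so the row itself, would lie in the span of the other rows.
\<close>
lemma independent_rows_transversal: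
  fixes x :: "'a \<Rightarrow> 'b \<Rightarrow> 'f::field"
  assumes "finite A" "finite B" "independent_rows A B x"
  shows "\<exists>\<sigma>. inj_on \<sigma> A \<and> \<sigma> ` A \<subseteq> B \<and> (\<forall>v\<in>A. x v (\<sigma> v) \<noteq> 0)"
  using assms
proof (induction A arbitrary: B rule: finite_induct)
  case empty
  then show ?case by simp
next
  case (insert v A)
  have indep: "independent_rows A B x"
    using insert.prems(2) by (rule independent_rows_subset) (use insert in auto)
  have "\<exists>b\<in>B. x v b \<noteq> 0 \<and> independent_rows A (B - {b}) x"
  proof (rule ccontr)
    assume none: "\<not> ?thesis"
    define S where "S = {b\<in>B. x v b \<noteq> 0}"
    have "\<forall>t\<in>S. \<exists>c. \<forall>b\<in>B. (\<Sum>w\<in>A. c w * x w b) = (if b = t then 1 else 0)"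
      using none unit_row_in_span[OF indep] unfolding S_def by blast
    then obtain C where
      C: "\<And>t b. t \<in> S \<Longrightarrow> b \<in> B \<Longrightarrow> (\<Sum>w\<in>A. C t w * x w b) = (if b = t then 1 else 0)"
      by metis
    define c where "c = (\<lambda>w. if w = v then - 1 else (\<Sum>t\<in>S. x v t * C t w))"
    have "(\<Sum>w\<in>insert v A. c w * x w b) = 0" if b: "b \<in> B" for b
    proof -
      have "(\<Sum>w\<in>A. c w * x w b) = (\<Sum>w\<in>A. \<Sum>t\<in>S. x v t * (C t w * x w b))"
        using insert.hyps(2) by (intro sum.cong) (auto simp: c_def sum_distrib_right mult.assoc)
      also have "\<dots> = (\<Sum>t\<in>S. x v t * (\<Sum>w\<in>A. C t w * x w b))"
        by (subst sum.swap) (simp add: sum_distrib_left)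
      also have "\<dots> = (\<Sum>t\<in>S. if b = t then x v t else 0)"
        using C b by (intro sum.cong) auto
      also have "\<dots> = x v b"
        using b insert.prems(1) by (auto simp: S_def)
      finally show ?thesis using insert.hyps by (simp add: c_def)
    qed
    then have "c v = 0"
      using insert.prems(2) unfolding independent_rows_def by (metis insertI1)
    then show False by (simp add: c_def)
  qed
  then obtain b where b: "b \<in> B" "x v b \<noteq> 0" "independent_rows A (B - {b}) x" by blast
  with insert.IH[of "B - {b}"] insert.prems(1) obtain \<sigma>
    where \<sigma>: "inj_on \<sigma> A" "\<sigma> ` A \<subseteq> B - {b}" "\<forall>v\<in>A. x v (\<sigma> v) \<noteq> 0" by auto
  have eq: "(\<sigma>(v := b)) ` A = \<sigma> ` A" using insert.hyps(2) by auto
  have "inj_on (\<sigma>(v := b)) (insert v A)"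
    using \<sigma> insert.hyps(2) by (auto simp: inj_on_def)
  moreover have "(\<sigma>(v := b)) ` insert v A \<subseteq> B" using \<sigma> b eq by auto
  moreover have "\<forall>w\<in>insert v A. x w ((\<sigma>(v := b)) w) \<noteq> 0" using \<sigma> b by auto
  ultimately show ?case by blast
qed

corollary independent_rows_card_le:
  assumes "finite A" "finite B" "independent_rows A B x"
  shows "card A \<le> card B"
  using independent_rows_transversal[OF assms] card_inj_on_le[OF _ _ assms(2)] by blast

text \<open>
  A square independent family is a basis: after deletion of the coordinate \<open>t\<close> there are more
  rows than coordinates, so the rows become dependent.
\<close>
corollary independent_rows_span:
  fixes x :: "'a \<Rightarrow> 'b \<Rightarrow> 'f::field"
  assumes "finite A" "finite B" "independent_rows A B x" "card A = card B" "t \<in> B"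
  shows "\<exists>c. \<forall>b\<in>B. (\<Sum>v\<in>A. c v * x v b) = (if b = t then 1 else 0)"
proof (rule unit_row_in_span[OF assms(3)])
  have "\<not> card A \<le> card (B - {t})"
    using assms by (metis card_Diff1_less not_le)
  then show "\<not> independent_rows A (B - {t}) x"
    using independent_rows_card_le[of A "B - {t}" x] assms(1,2) by auto
qed

section \<open>Recovering a graph from its vanishing minors\<close>

definition nonneighbours :: "'v set \<Rightarrow> 'v set set \<Rightarrow> 'v \<Rightarrow> 'v set" where
  "nonneighbours V E v = {u \<in> V. u \<noteq> v \<and> {v, u} \<notin> E}"

lemma simplicial_graph_no_loop: "simplicial_graph V E \<Longrightarrow> {v, v} \<notin> E"
  unfolding simplicial_graph_def by (auto simp: doubleton_eq_iff)

lemma simplicial_graph_edge_vertex: "simplicial_graph V E \<Longrightarrow> {v, w} \<in> E \<Longrightarrow> v \<in> V \<and> w \<in> V"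
  unfolding simplicial_graph_def by (auto simp: doubleton_eq_iff)

text \<open>
  The row \<open>X v\<close> is the coordinate vector of the image of the class dual to the vertex \<open>v\<close>.
  The minors at an edge \<open>{a, b}\<close> are the coordinates of a cup product, so the condition on minors
  says that classes dual to distinct nonadjacent vertices have images with cup product zero.
\<close>
locale graph_matrix =
  fixes V :: "'v set" and E :: "'v set set" and V' :: "'w set" and E' :: "'w set set"
    and X :: "'v \<Rightarrow> 'w \<Rightarrow> 'f::field"
  assumes graph: "simplicial_graph V E" and graph': "simplicial_graph V' E'"
    and indep: "independent_rows V V' X"
    and minor: "\<And>v w a b. v \<in> V \<Longrightarrow> w \<in> V \<Longrightarrow> {v, w} \<notin> E \<Longrightarrow> {a, b} \<in> E' \<Longrightarrow>
                  X v a * X w b = X v b * X w a"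
begin

lemma fin: "finite V" "finite V'"
  using graph graph' by (auto simp: simplicial_graph_def)

lemma fin_nonneighbours: "finite (nonneighbours V E v)" "finite (nonneighbours V' E' a)"
  using fin by (auto simp: nonneighbours_def)

text \<open>
  The rows \<open>X u\<close> with \<open>u\<close> not adjacent to \<open>v\<close> all pair to zero with \<open>X v\<close>. Clearing the coordinate
  \<open>a\<close> with the help of \<open>X v\<close> therefore also clears the coordinates of all neighbours of \<open>a\<close>: the
  minor at an edge \<open>{a, b}\<close> has become \<open>X v a * y u b\<close>. What is left lives on the nonneighbours
  of \<open>a\<close>.
\<close>
lemma nonneighbours_eliminate:
  assumes v: "v \<in> V" and a: "a \<in> V'" and nz: "X v a \<noteq> 0"
  defines "y \<equiv> \<lambda>u b. X u b - X u a / X v a * X v b"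
  shows eliminate_support:
      "\<And>u b. u \<in> V \<Longrightarrow> {v, u} \<notin> E \<Longrightarrow> b \<in> V' \<Longrightarrow> b \<notin> nonneighbours V' E' a \<Longrightarrow> y u b = 0"
    and eliminate_independent:
      "independent_rows (nonneighbours V E v) (nonneighbours V' E' a) y"
proof -
  show supp: "y u b = 0"
    if "u \<in> V" "{v, u} \<notin> E" "b \<in> V'" "b \<notin> nonneighbours V' E' a" for u b
  proof (cases "b = a")
    case True
    then show ?thesis using nz by (simp add: y_def)
  next
    case False
    then have "{a, b} \<in> E'" using that by (auto simp: nonneighbours_def)
    then have "X v a * X u b = X v b * X u a" using minor v that by blast
    then show ?thesis using nz by (simp add: y_def field_simps)
  qed
  show "independent_rows (nonneighbours V E v) (nonneighbours V' E' a) y"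
    unfolding independent_rows_def
  proof (intro allI impI)
    fix c assume c: "\<forall>b\<in>nonneighbours V' E' a. (\<Sum>u\<in>nonneighbours V E v. c u * y u b) = 0"
    let ?N = "nonneighbours V E v"
    define k where "k = (\<Sum>u\<in>?N. c u * (X u a / X v a))"
    \<comment> \<open>A relation among the reduced rows is a relation among the rows of \<open>X\<close> with coefficient
      \<open>- k\<close> at \<open>v\<close>.\<close>
    define c' where "c' = (\<lambda>u. if u = v then - k else c u)"
    have vN: "v \<notin> ?N" "?N \<subseteq> V" by (auto simp: nonneighbours_def)
    have "(\<Sum>u\<in>insert v ?N. c' u * X u b) = 0" if b: "b \<in> V'" for b
    proof -
      have "(\<Sum>u\<in>?N. c u * y u b) = 0"
      proof (cases "b \<in> nonneighbours V' E' a")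
        case False
        then show ?thesis using supp b by (intro sum.neutral) (auto simp: nonneighbours_def)
      qed (use c in blast)
      moreover have "(\<Sum>u\<in>?N. c u * y u b) = (\<Sum>u\<in>?N. c u * X u b) - k * X v b"
        unfolding k_def sum_distrib_right sum_subtractf[symmetric]
        by (simp add: y_def algebra_simps)
      moreover have "(\<Sum>u\<in>?N. c' u * X u b) = (\<Sum>u\<in>?N. c u * X u b)"
        using vN by (intro sum.cong) (auto simp: c'_def)
      ultimately show ?thesis
        using vN fin_nonneighbours by (simp add: c'_def)
    qed
    moreover have "independent_rows (insert v ?N) V' X"
      using independent_rows_subset[OF indep] v vN fin by auto
    ultimately have "\<forall>u\<in>insert v ?N. c' u = 0" unfolding independent_rows_def by blast
    then show "\<forall>u\<in>?N. c u = 0" using vN by (auto simp: c'_def split: if_splits)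
  qed
qed

lemma nonneighbours_card_le:
  assumes "v \<in> V" "a \<in> V'" "X v a \<noteq> 0"
  shows "card (nonneighbours V E v) \<le> card (nonneighbours V' E' a)"
  using independent_rows_card_le[OF fin_nonneighbours eliminate_independent[OF assms]] .

text \<open>
  This is the case of equality in the preceding inequality. The reduced rows then span all vectors
  supported on the nonneighbours of \<open>a\<close>, so the unit vector at \<open>t\<close> is a combination of rows that
  pair to zero with \<open>X v\<close>. Its pairing with \<open>X v\<close> at the edge \<open>{t, s}\<close> is \<open>X v s\<close> up to sign.
\<close>
lemma support_avoids_neighbours:
  assumes v: "v \<in> V" and a: "a \<in> V'" and nz: "X v a \<noteq> 0"
    and card: "card (nonneighbours V E v) = card (nonneighbours V' E' a)"
    and t: "t \<in> nonneighbours V' E' a" and edge: "{t, s} \<in> E'"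
  shows "X v s = 0"
proof -
  let ?N = "nonneighbours V E v"
  define y where "y = (\<lambda>u b. X u b - X u a / X v a * X v b)"
  obtain c where c: "\<forall>b\<in>nonneighbours V' E' a. (\<Sum>u\<in>?N. c u * y u b) = (if b = t then 1 else 0)"
    using independent_rows_span[OF fin_nonneighbours eliminate_independent[OF v a nz] card t]
    unfolding y_def by blast
  have unit: "(\<Sum>u\<in>?N. c u * y u b) = (if b = t then 1 else 0)" if b: "b \<in> V'" for b
  proof (cases "b \<in> nonneighbours V' E' a")
    case False
    then have "(\<Sum>u\<in>?N. c u * y u b) = 0"
      using eliminate_support[OF v a nz] b
      by (intro sum.neutral) (auto simp: nonneighbours_def y_def)
    then show ?thesis using False t by auto
  qed (use c in blast)
  have ts: "t \<in> V'" "s \<in> V'" "s \<noteq> t"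
    using simplicial_graph_edge_vertex[OF graph' edge] simplicial_graph_no_loop[OF graph'] edge
    by auto
  have "X v t * (c u * y u s) = X v s * (c u * y u t)" if "u \<in> ?N" for u
  proof -
    have "X v t * X u s = X v s * X u t"
      using minor v that edge by (auto simp: nonneighbours_def)
    then have "X v t * y u s = X v s * y u t" by (simp add: y_def algebra_simps)
    then show ?thesis by (simp add: algebra_simps)
  qed
  then have "X v t * (\<Sum>u\<in>?N. c u * y u s) = X v s * (\<Sum>u\<in>?N. c u * y u t)"
    unfolding sum_distrib_left by (rule sum.cong[OF HOL.refl])
  then show ?thesis using unit ts by simp
qed

end

locale inverse_graph_matrices =
  fixes V :: "'v set" and E :: "'v set set" and V' :: "'w set" and E' :: "'w set set"
    and X :: "'v \<Rightarrow> 'w \<Rightarrow> 'f::field" and Y :: "'w \<Rightarrow> 'v \<Rightarrow> 'f"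
  assumes graph: "simplicial_graph V E" and graph': "simplicial_graph V' E'"
    and XY: "\<And>v w. v \<in> V \<Longrightarrow> w \<in> V \<Longrightarrow> (\<Sum>a\<in>V'. X v a * Y a w) = (if v = w then 1 else 0)"
    and YX: "\<And>a b. a \<in> V' \<Longrightarrow> b \<in> V' \<Longrightarrow> (\<Sum>v\<in>V. Y a v * X v b) = (if a = b then 1 else 0)"
    and minorX: "\<And>v w a b. v \<in> V \<Longrightarrow> w \<in> V \<Longrightarrow> {v, w} \<notin> E \<Longrightarrow> {a, b} \<in> E' \<Longrightarrow>
                  X v a * X w b = X v b * X w a"
    and minorY: "\<And>a b v w. a \<in> V' \<Longrightarrow> b \<in> V' \<Longrightarrow> {a, b} \<notin> E' \<Longrightarrow> {v, w} \<in> E \<Longrightarrow>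
                  Y a v * Y b w = Y a w * Y b v"
begin

lemma swapped: "inverse_graph_matrices V' E' V E Y X"
  using graph graph' XY YX minorX minorY unfolding inverse_graph_matrices_def by blast

lemma fin: "finite V" "finite V'"
  using graph graph' by (auto simp: simplicial_graph_def)

lemma independent: "independent_rows V V' X"
  unfolding independent_rows_def
proof (intro allI impI ballI)
  fix c w assume c: "\<forall>a\<in>V'. (\<Sum>v\<in>V. c v * X v a) = 0" and w: "w \<in> V"
  have "0 = (\<Sum>a\<in>V'. (\<Sum>v\<in>V. c v * X v a) * Y a w)" using c by simp
  also have "\<dots> = (\<Sum>v\<in>V. c v * (\<Sum>a\<in>V'. X v a * Y a w))"
    by (simp add: sum_distrib_left sum_distrib_right mult.assoc) (rule sum.swap)
  also have "\<dots> = (\<Sum>v\<in>V. if v = w then c v else 0)"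
    using XY w by (intro sum.cong) auto
  also have "\<dots> = c w" using w fin by simp
  finally show "c w = 0" by simp
qed

end

sublocale inverse_graph_matrices \<subseteq> graph_matrix V E V' E' X
  using graph graph' independent minorX by unfold_locales

context inverse_graph_matrices
begin

abbreviation "level v \<equiv> card (nonneighbours V E v)"
abbreviation "level' a \<equiv> card (nonneighbours V' E' a)"

lemma transversal:
  obtains \<sigma> where "bij_betw \<sigma> V V'" "\<And>v. v \<in> V \<Longrightarrow> X v (\<sigma> v) \<noteq> 0"
proof -
  interpret swap: inverse_graph_matrices V' E' V E Y X by (rule swapped)
  obtain \<sigma> where \<sigma>: "inj_on \<sigma> V" "\<sigma> ` V \<subseteq> V'" "\<forall>v\<in>V. X v (\<sigma> v) \<noteq> 0"
    using independent_rows_transversal[OF fin independent] by blast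
  have "card V = card V'"
    using independent_rows_card_le[OF fin independent]
      independent_rows_card_le[OF swap.fin swap.independent] by simp
  then have "\<sigma> ` V = V'" using \<sigma> fin by (metis card_image card_subset_eq)
  then show ?thesis using \<sigma> that by (auto simp: bij_betw_def)
qed

lemma sum_level_le: "(\<Sum>v\<in>V. level v) \<le> (\<Sum>a\<in>V'. level' a)"
proof -
  obtain \<sigma> where \<sigma>: "bij_betw \<sigma> V V'" "\<And>v. v \<in> V \<Longrightarrow> X v (\<sigma> v) \<noteq> 0"
    by (rule transversal) blast
  have "(\<Sum>v\<in>V. level v) \<le> (\<Sum>v\<in>V. level' (\<sigma> v))"
    using \<sigma> by (intro sum_mono nonneighbours_card_le) (auto dest: bij_betwE)
  also have "\<dots> = (\<Sum>a\<in>V'. level' a)" using \<sigma>(1) by (rule sum.reindex_bij_betw)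
  finally show ?thesis .
qed

text \<open>
  Along a transversal the number of nonneighbours does not drop. Since the same holds for the
  inverse matrix, the two graphs have the same total number of nonneighbours, and so the number
  is constant along the transversal.
\<close>
lemma transversal_level:
  assumes \<sigma>: "bij_betw \<sigma> V V'" "\<And>v. v \<in> V \<Longrightarrow> X v (\<sigma> v) \<noteq> 0" and v: "v \<in> V"
  shows "level' (\<sigma> v) = level v"
proof -
  interpret swap: inverse_graph_matrices V' E' V E Y X by (rule swapped)
  have le: "level v \<le> level' (\<sigma> v)" if "v \<in> V" for v
    using \<sigma> that by (intro nonneighbours_card_le) (auto dest: bij_betwE)
  have "(\<Sum>v\<in>V. level' (\<sigma> v)) = (\<Sum>a\<in>V'. level' a)" using \<sigma>(1) by (rule sum.reindex_bij_betw)
  also have "\<dots> = (\<Sum>v\<in>V. level v)" using sum_level_le swap.sum_level_le by (rule antisym[rotated])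
  finally show ?thesis using sum_mono_inv[of level V "\<lambda>v. level' (\<sigma> v)"] le v fin by metis
qed

text \<open>
  A minor of the rows \<open>v\<close> and \<open>w\<close> can vanish although its diagonal entries do not, so an argument
  beyond the choice of a transversal is needed. If \<open>a = \<sigma> v\<close> and \<open>b = \<sigma> w\<close> were adjacent, all four
  entries of the minor would be nonzero, and \<open>v, w, a, b\<close> would have the same level. Let \<open>z\<close> be the
  row \<open>w\<close> with its coordinate \<open>a\<close> cleared by means of the row \<open>v\<close>. The support of \<open>z\<close> consists of
  vertices of strictly higher level, because a vertex \<open>u\<close> of the same level that is not adjacent to
  \<open>a\<close> cannot share the support of a row of that level with the edge \<open>{a, b}\<close>. The inverse matrix
  never lowers levels, so it sends \<open>z\<close> to a vector with zero coordinate at \<open>w\<close>. But this coordinate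
  is \<open>1\<close>, since \<open>z\<close> comes from the unit vector at \<open>w\<close> minus a multiple of the one at \<open>v\<close>.
\<close>
lemma transversal_nonadjacent:
  assumes \<sigma>: "bij_betw \<sigma> V V'" "\<And>v. v \<in> V \<Longrightarrow> X v (\<sigma> v) \<noteq> 0"
    and vw: "v \<in> V" "w \<in> V" "v \<noteq> w" "{v, w} \<notin> E"
  shows "{\<sigma> v, \<sigma> w} \<notin> E'"
proof
  interpret swap: inverse_graph_matrices V' E' V E Y X by (rule swapped)
  define a b where "a = \<sigma> v" and "b = \<sigma> w"
  assume "{\<sigma> v, \<sigma> w} \<in> E'"
  then have ab: "{a, b} \<in> E'" "a \<in> V'" "b \<in> V'"
    using simplicial_graph_edge_vertex[OF graph'] by (auto simp: a_def b_def)
  have nz: "X v a \<noteq> 0" "X w b \<noteq> 0" using \<sigma> vw by (auto simp: a_def b_def)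
  have "X v a * X w b = X v b * X w a" using minorX vw ab by blast
  with nz have nz': "X v b \<noteq> 0" "X w a \<noteq> 0" by auto
  have "level v \<le> level' b" "level w \<le> level' a"
    using nonneighbours_card_le vw ab nz' by auto
  moreover have "level' a = level v" "level' b = level w"
    using transversal_level[OF \<sigma>] vw by (auto simp: a_def b_def)
  ultimately have lev: "level w = level v" "level' a = level v" "level' b = level v" by auto
  define z where "z = (\<lambda>u. X w u - X w a / X v a * X v u)"
  have z_high: "level v < level' u" if u: "u \<in> V'" "z u \<noteq> 0" for u
  proof -
    have uN: "u \<in> nonneighbours V' E' a"
      using eliminate_support[OF vw(1) ab(2) nz(1) vw(2) vw(4) u(1)] u(2) by (auto simp: z_def)
    then have aN: "a \<in> nonneighbours V' E' u"
      using ab by (auto simp: nonneighbours_def insert_commute)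
    \<comment> \<open>Both rows meet \<open>a\<close> and \<open>b\<close>, so either of them can serve as \<open>r\<close>.\<close>
    have "X v u \<noteq> 0 \<or> X w u \<noteq> 0" using u(2) by (auto simp: z_def)
    then obtain r where r: "r \<in> V" "X r u \<noteq> 0" "X r b \<noteq> 0" "level r = level v"
      using vw nz nz' lev by blast
    have "level r \<le> level' u" using nonneighbours_card_le r u by blast
    moreover have "level r \<noteq> level' u"
      using support_avoids_neighbours[OF r(1) u(1) r(2) _ aN ab(1)] r(3) by blast
    ultimately show ?thesis using r by simp
  qed
  have "z u * Y u w = 0" if "u \<in> V'" for u
    using z_high[OF that] swap.nonneighbours_card_le[OF that vw(2)] lev by fastforce
  then have "0 = (\<Sum>u\<in>V'. z u * Y u w)" by (simp del: mult_eq_0_iff)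
  also have "\<dots> = (\<Sum>u\<in>V'. X w u * Y u w) - X w a / X v a * (\<Sum>u\<in>V'. X v u * Y u w)"
    by (simp add: z_def algebra_simps sum_subtractf sum_distrib_left)
  also have "\<dots> = 1" using XY vw by simp
  finally show False by simp
qed

lemma graph_isomorphic_of_inverse_matrices: "graph_isomorphic V E V' E'"
proof -
  obtain \<sigma> where \<sigma>: "bij_betw \<sigma> V V'" "\<And>v. v \<in> V \<Longrightarrow> X v (\<sigma> v) \<noteq> 0"
    by (rule transversal) blast
  have inj: "inj_on \<sigma> V" and img: "\<sigma> ` V = V'" using \<sigma>(1) by (auto simp: bij_betw_def)
  \<comment> \<open>Nonadjacency is preserved by \<open>\<sigma>\<close>; that it is also reflected follows by counting.\<close>
  have N: "\<sigma> ` nonneighbours V E v = nonneighbours V' E' (\<sigma> v)" if v: "v \<in> V" for v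
  proof (rule card_subset_eq[OF fin_nonneighbours(2)])
    have sub: "nonneighbours V E v \<subseteq> V" by (auto simp: nonneighbours_def)
    show "\<sigma> ` nonneighbours V E v \<subseteq> nonneighbours V' E' (\<sigma> v)"
      using transversal_nonadjacent[OF \<sigma>] v inj img
      by (auto simp: nonneighbours_def inj_on_def)
    show "card (\<sigma> ` nonneighbours V E v) = level' (\<sigma> v)"
      using transversal_level[OF \<sigma> v] card_image[OF inj_on_subset[OF inj sub]] by simp
  qed
  have "{v, w} \<in> E \<longleftrightarrow> {\<sigma> v, \<sigma> w} \<in> E'" if v: "v \<in> V" and w: "w \<in> V" for v w
  proof (cases "v = w")
    case True
    then show ?thesis
      using simplicial_graph_no_loop[OF graph] simplicial_graph_no_loop[OF graph'] by auto
  next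
    case False
    then have "\<sigma> v \<noteq> \<sigma> w" using inj v w by (auto simp: inj_on_def)
    have "{v, w} \<notin> E \<longleftrightarrow> w \<in> nonneighbours V E v"
      using False w by (auto simp: nonneighbours_def)
    also have "\<dots> \<longleftrightarrow> \<sigma> w \<in> nonneighbours V' E' (\<sigma> v)"
      unfolding N[OF v, symmetric]
      using inj w by (auto simp: nonneighbours_def inj_on_def)
    also have "\<dots> \<longleftrightarrow> {\<sigma> v, \<sigma> w} \<notin> E'"
      using \<open>\<sigma> v \<noteq> \<sigma> w\<close> img w by (auto simp: nonneighbours_def)
    finally show ?thesis by blast
  qed
  then show ?thesis using \<sigma>(1) unfolding graph_isomorphic_def by blast
qed

end

section \<open>Presented groups\<close>

locale presentation =
  fixes S :: "'s set" and R :: "'s word set"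
  assumes relators: "R \<subseteq> words S"
begin

definition cls :: "'s word \<Rightarrow> 's word set" where
  "cls u = pres_rel S R `` {u}"

abbreviation "G \<equiv> presented_group S R"

lemma pres_rel_words: "(u, v) \<in> pres_rel S R \<Longrightarrow> u \<in> words S \<and> v \<in> words S"
  by (induction rule: pres_rel.induct) (use relators in auto)

lemma pres_rel_append:
  assumes "(u, v) \<in> pres_rel S R" "p \<in> words S" "q \<in> words S"
  shows "(p @ u @ q, p @ v @ q) \<in> pres_rel S R"
  using assms(1)
proof (induction rule: pres_rel.induct)
  case (refl u)
  then show ?case using assms(2,3) by (intro pres_rel.refl) auto
next
  case (sym u v)
  then show ?case by (metis pres_rel.sym)
next
  case (trans u v w)
  then show ?case by (metis pres_rel.trans)
next
  case (cancel u v s b)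
  then show ?case
    using pres_rel.cancel[of "p @ u" S "v @ q" s b R] assms(2,3) by simp
next
  case (relator u v r)
  then show ?case
    using pres_rel.relator[of "p @ u" S "v @ q" r R] assms(2,3) by simp
qed

lemma cls_eqI: "(u, v) \<in> pres_rel S R \<Longrightarrow> cls u = cls v"
  unfolding cls_def using pres_rel.trans pres_rel.sym by fast

lemma carrier_presented: "carrier G = cls ` words S"
  unfolding presented_group_def by (auto simp: quotient_def cls_def)

lemma cls_in_carrier: "u \<in> words S \<Longrightarrow> cls u \<in> carrier G"
  unfolding carrier_presented by blast

lemma self_in_cls: "u \<in> words S \<Longrightarrow> u \<in> cls u"
  unfolding cls_def by (blast intro: pres_rel.refl)

lemma mult_cls:
  assumes "u \<in> words S" "v \<in> words S"
  shows "cls u \<otimes>\<^bsub>G\<^esub> cls v = cls (u @ v)"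
proof -
  have "cls (u' @ v') = cls (u @ v)" if "u' \<in> cls u" "v' \<in> cls v" for u' v'
  proof (rule cls_eqI)
    have u': "(u', u) \<in> pres_rel S R" and v': "(v', v) \<in> pres_rel S R"
      using that pres_rel.sym unfolding cls_def Image_singleton_iff by metis+
    have "(u' @ v', u @ v') \<in> pres_rel S R"
      using pres_rel_append[OF u', of "[]" v'] pres_rel_words[OF v'] by simp
    moreover have "(u @ v', u @ v) \<in> pres_rel S R"
      using pres_rel_append[OF v', of u "[]"] assms by simp
    ultimately show "(u' @ v', u @ v) \<in> pres_rel S R" by (rule pres_rel.trans)
  qed
  then have "(\<Union>u'\<in>cls u. \<Union>v'\<in>cls v. cls (u' @ v')) = (\<Union>u'\<in>cls u. \<Union>v'\<in>cls v. cls (u @ v))"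
    by (intro SUP_cong HOL.refl) blast
  also have "\<dots> = cls (u @ v)"
    using self_in_cls[OF assms(1)] self_in_cls[OF assms(2)] by blast
  finally show ?thesis by (simp add: presented_group_def cls_def)
qed

lemma mult_closed:
  assumes "g \<in> carrier G" "h \<in> carrier G"
  shows "g \<otimes>\<^bsub>G\<^esub> h \<in> carrier G"
proof -
  obtain u v where uv: "u \<in> words S" "v \<in> words S" "g = cls u" "h = cls v"
    using assms unfolding carrier_presented by blast
  then have "u @ v \<in> words S" by simp
  then show ?thesis unfolding uv mult_cls[OF uv(1,2)] by (rule cls_in_carrier)
qed

text \<open>
  The value at a class of a function that is constant on classes of words.
\<close>
definition descend :: "('s word \<Rightarrow> 'a) \<Rightarrow> 's word set \<Rightarrow> 'a" where
  "descend f g = f (SOME u. u \<in> g)"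

lemma descend_cls:
  assumes "\<And>u v. (u, v) \<in> pres_rel S R \<Longrightarrow> f u = f v" "u \<in> words S"
  shows "descend f (cls u) = f u"
proof -
  have "(SOME v. v \<in> cls u) \<in> cls u" using self_in_cls[OF assms(2)] by (rule someI)
  then show ?thesis using assms(1) by (auto simp: descend_def cls_def)
qed

end

section \<open>Word functions\<close>

fun letter_value :: "('s \<Rightarrow> 'f::field) \<Rightarrow> 's \<times> bool \<Rightarrow> 'f" where
  "letter_value x (s, b) = (if b then x s else - x s)"

definition word_value :: "('s \<Rightarrow> 'f::field) \<Rightarrow> 's word \<Rightarrow> 'f" where
  "word_value x u = (\<Sum>l\<leftarrow>u. letter_value x l)"

lemma word_value_simps [simp]:
  "word_value x [] = 0" "word_value x (l # u) = letter_value x l + word_value x u"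
  "word_value x (u @ v) = word_value x u + word_value x v"
  by (simp_all add: word_value_def)

text \<open>
  If the generator \<open>s\<close> is sent to the unipotent upper triangular \<open>3 \<times> 3\<close> matrix with entries
  \<open>x s\<close> and \<open>y s\<close> above the diagonal and \<open>0\<close> in the corner, then \<open>heisenberg x y u\<close> is the negative
  of the corner entry of the image of the word \<open>u\<close>. The term \<open>- (x s * y s)\<close> comes from the corner
  of the inverse matrix.
\<close>
fun heisenberg :: "('s \<Rightarrow> 'f::field) \<Rightarrow> ('s \<Rightarrow> 'f) \<Rightarrow> 's word \<Rightarrow> 'f" where
  "heisenberg x y [] = 0"
| "heisenberg x y ((s, b) # u) =
     (if b then 0 else - (x s * y s)) + heisenberg x y u - letter_value x (s, b) * word_value y u"

lemma heisenberg_append: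
  "heisenberg x y (u @ v) = heisenberg x y u + heisenberg x y v - word_value x u * word_value y v"
  by (induction x y u rule: heisenberg.induct) (auto simp: algebra_simps)

section \<open>Low-degree bar cochains\<close>

lemma coboundaries_1: "coboundaries G 1 = {\<lambda>_. 0}"
proof -
  have "coboundary G 0 f = (\<lambda>_. 0)" for f :: "'a list \<Rightarrow> 'b"
    by (auto simp: coboundary_def fun_eq_iff length_Suc_conv)
  moreover have "(\<lambda>_. 0) \<in> cochains G 0" by (simp add: cochains_def)
  ultimately show ?thesis by (auto simp: coboundaries_def)
qed

lemma length_2_iff: "length gs = 2 \<longleftrightarrow> (\<exists>a b. gs = [a, b])"
  by (auto simp: numeral_2_eq_2 length_Suc_conv)

lemma length_3_iff: "length gs = 3 \<longleftrightarrow> (\<exists>a b c. gs = [a, b, c])"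
  by (auto simp: numeral_3_eq_3 length_Suc_conv)

lemma coboundary_1_apply:
  "a \<in> carrier G \<Longrightarrow> b \<in> carrier G \<Longrightarrow> coboundary G 1 f [a, b] = f [b] - f [a \<otimes>\<^bsub>G\<^esub> b] + f [a]"
  by (simp add: coboundary_def)

lemma coboundary_1_outside:
  "\<not> (\<exists>a\<in>carrier G. \<exists>b\<in>carrier G. gs = [a, b]) \<Longrightarrow> coboundary G 1 f gs = 0"
  by (auto simp: coboundary_def length_Suc_conv)

lemma coboundary_2_apply:
  "a \<in> carrier G \<Longrightarrow> b \<in> carrier G \<Longrightarrow> c \<in> carrier G \<Longrightarrow>
   coboundary G 2 f [a, b, c] =
     f [b, c] - f [a \<otimes>\<^bsub>G\<^esub> b, c] + f [a, b \<otimes>\<^bsub>G\<^esub> c] - f [a, b]"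
  by (simp add: coboundary_def numeral_2_eq_2)

lemma coboundary_2_outside:
  "\<not> (\<exists>a\<in>carrier G. \<exists>b\<in>carrier G. \<exists>c\<in>carrier G. gs = [a, b, c]) \<Longrightarrow> coboundary G 2 f gs = 0"
  by (auto simp: coboundary_def length_3_iff)

lemma cocycles_1_iff:
  "f \<in> cocycles G 1 \<longleftrightarrow>
     f \<in> cochains G 1 \<and> (\<forall>a\<in>carrier G. \<forall>b\<in>carrier G. f [a \<otimes>\<^bsub>G\<^esub> b] = f [a] + f [b])"
proof -
  have "coboundary G 1 f = (\<lambda>_. 0) \<longleftrightarrow>
      (\<forall>a\<in>carrier G. \<forall>b\<in>carrier G. f [a \<otimes>\<^bsub>G\<^esub> b] = f [a] + f [b])"
  proof
    assume "coboundary G 1 f = (\<lambda>_. 0)"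
    then show "\<forall>a\<in>carrier G. \<forall>b\<in>carrier G. f [a \<otimes>\<^bsub>G\<^esub> b] = f [a] + f [b]"
      using coboundary_1_apply[of _ G _ f] by (simp add: algebra_simps)
  next
    assume hom: "\<forall>a\<in>carrier G. \<forall>b\<in>carrier G. f [a \<otimes>\<^bsub>G\<^esub> b] = f [a] + f [b]"
    show "coboundary G 1 f = (\<lambda>_. 0)"
    proof
      fix gs show "coboundary G 1 f gs = 0"
      proof (cases "\<exists>a\<in>carrier G. \<exists>b\<in>carrier G. gs = [a, b]")
        case True
        then show ?thesis using hom coboundary_1_apply[of _ G _ f] by auto
      qed (rule coboundary_1_outside)
    qed
  qed
  then show ?thesis by (auto simp: cocycles_def)
qed

lemma cohomology_class_1: "cohomology_class G 1 f = {f}"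
  by (simp add: cohomology_class_def coboundaries_1 a_r_coset_def r_coset_def cocycle_space_def
      del: One_nat_def)

lemma carrier_cohomology: "carrier (cohomology G n) = cohomology_class G n ` cocycles G n"
  by (auto simp: cohomology_def cohomology_class_def A_RCOSETS_def RCOSETS_def
      a_r_coset_def cocycle_space_def)

lemma add_class:
  fixes f g :: "'g list \<Rightarrow> 'f::field"
  shows "cohomology_class G n f \<oplus>\<^bsub>cohomology G n\<^esub> cohomology_class G n g =
   {\<lambda>gs. h gs + f gs + (k gs + g gs) |h k. h \<in> coboundaries G n \<and> k \<in> coboundaries G n}"
  by (auto simp: cohomology_def cohomology_class_def set_add_def set_mult_def
      a_r_coset_def r_coset_def cocycle_space_def)

lemma mem_class: "h \<in> cohomology_class G n f \<longleftrightarrow> (\<exists>k\<in>coboundaries G n. h = (\<lambda>gs. k gs + f gs))"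
  by (auto simp: cohomology_class_def a_r_coset_def r_coset_def cocycle_space_def)

lemma coboundaries_2: "coboundaries G 2 = coboundary G 1 ` cochains G 1"
  by (simp add: coboundaries_def numeral_2_eq_2)

lemma coboundaries_2_lin:
  fixes f g :: "'g list \<Rightarrow> 'f::field"
  assumes "f \<in> coboundaries G 2" "g \<in> coboundaries G 2"
  shows "(\<lambda>gs. f gs + c * g gs) \<in> coboundaries G 2"
proof -
  obtain h k where hk: "h \<in> cochains G 1" "f = coboundary G 1 h" "k \<in> cochains G 1" "g = coboundary G 1 k"
    using assms unfolding coboundaries_2 by blast
  have "coboundary G 1 (\<lambda>gs. h gs + c * k gs) = (\<lambda>gs. f gs + c * g gs)"
    unfolding hk by (auto simp: coboundary_def fun_eq_iff algebra_simps)
  moreover have "(\<lambda>gs. h gs + c * k gs) \<in> cochains G 1" using hk by (auto simp: cochains_def)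
  ultimately show ?thesis unfolding coboundaries_2 by (rule image_eqI[OF HOL.sym])
qed

lemma zero_coboundary_2: "(\<lambda>_. 0) \<in> coboundaries G 2"
proof -
  have "coboundary G 1 (\<lambda>_. 0) = (\<lambda>_. 0)" by (auto simp: coboundary_def)
  moreover have "(\<lambda>_. 0) \<in> cochains G 1" by (simp add: cochains_def)
  ultimately show ?thesis unfolding coboundaries_2 by (rule image_eqI[OF HOL.sym])
qed

lemma add_class_2:
  fixes f g :: "'g list \<Rightarrow> 'f::field"
  shows "cohomology_class G 2 f \<oplus>\<^bsub>cohomology G 2\<^esub> cohomology_class G 2 g =
    cohomology_class G 2 (\<lambda>gs. f gs + g gs)"
proof (rule Set.set_eqI)
  fix m
  show "m \<in> cohomology_class G 2 f \<oplus>\<^bsub>cohomology G 2\<^esub> cohomology_class G 2 g \<longleftrightarrow>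
    m \<in> cohomology_class G 2 (\<lambda>gs. f gs + g gs)"
  proof
    assume "m \<in> cohomology_class G 2 f \<oplus>\<^bsub>cohomology G 2\<^esub> cohomology_class G 2 g"
    then obtain h k where hk: "h \<in> coboundaries G 2" "k \<in> coboundaries G 2"
      "m = (\<lambda>gs. h gs + f gs + (k gs + g gs))" unfolding add_class by blast
    have "m = (\<lambda>gs. (h gs + 1 * k gs) + (f gs + g gs))" using hk by (simp add: algebra_simps)
    then show "m \<in> cohomology_class G 2 (\<lambda>gs. f gs + g gs)"
      unfolding mem_class using coboundaries_2_lin[OF hk(1,2), of 1] by (rule bexI)
  next
    assume "m \<in> cohomology_class G 2 (\<lambda>gs. f gs + g gs)"
    then obtain h where h: "h \<in> coboundaries G 2" "m = (\<lambda>gs. h gs + (f gs + g gs))"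
      unfolding mem_class by blast
    have "m = (\<lambda>gs. h gs + f gs + ((\<lambda>_. 0) gs + g gs))" using h by (simp add: algebra_simps)
    then show "m \<in> cohomology_class G 2 f \<oplus>\<^bsub>cohomology G 2\<^esub> cohomology_class G 2 g"
      unfolding add_class using h(1) zero_coboundary_2[of G]
      by (intro CollectI exI[of _ h] exI[of _ "\<lambda>_. 0"] conjI)
  qed
qed

text \<open>
  The zero class is the only idempotent for addition. An additive bijection visibly preserves
  idempotents, so vanishing of classes can be transported without a description of the zero of
  the cohomology module.
\<close>
lemma class_2_idem_iff:
  fixes f :: "'g list \<Rightarrow> 'f::field"
  shows "cohomology_class G 2 f \<oplus>\<^bsub>cohomology G 2\<^esub> cohomology_class G 2 f = cohomology_class G 2 f
    \<longleftrightarrow> f \<in> coboundaries G 2"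
proof
  assume "cohomology_class G 2 f \<oplus>\<^bsub>cohomology G 2\<^esub> cohomology_class G 2 f = cohomology_class G 2 f"
  moreover have "(\<lambda>gs. f gs + f gs) \<in> cohomology_class G 2 (\<lambda>gs. f gs + f gs)"
    unfolding mem_class by (rule bexI[OF _ zero_coboundary_2]) simp
  ultimately have "(\<lambda>gs. f gs + f gs) \<in> cohomology_class G 2 f" by (simp add: add_class_2)
  then obtain k where "k \<in> coboundaries G 2" "\<And>gs. f gs + f gs = k gs + f gs"
    unfolding mem_class by (metis (mono_tags))
  then show "f \<in> coboundaries G 2" by (metis add_right_cancel ext)
next
  assume f: "f \<in> coboundaries G 2"
  have "m \<in> cohomology_class G 2 g \<longleftrightarrow> m \<in> coboundaries G 2"
    if g: "g \<in> coboundaries G 2" for g m :: "'g list \<Rightarrow> 'f"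
  proof
    assume "m \<in> cohomology_class G 2 g"
    then show "m \<in> coboundaries G 2" using coboundaries_2_lin[OF _ g, of _ 1] by (auto simp: mem_class)
  next
    assume "m \<in> coboundaries G 2"
    then show "m \<in> cohomology_class G 2 g"
      unfolding mem_class using coboundaries_2_lin[OF _ g, of m "-1"]
      by (intro bexI[of _ "\<lambda>gs. m gs + -1 * g gs"]) auto
  qed
  then have "cohomology_class G 2 g = coboundaries G 2" if "g \<in> coboundaries G 2" for g :: "'g list \<Rightarrow> 'f"
    using that by blast
  then show "cohomology_class G 2 f \<oplus>\<^bsub>cohomology G 2\<^esub> cohomology_class G 2 f = cohomology_class G 2 f"
    unfolding add_class_2 using f coboundaries_2_lin[OF f f, of 1] by simp
qed

lemma cup_1_1: "cup G 1 1 {f} {g} = cohomology_class G 2 (cup_cochain 1 f g)"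
  by (simp add: cup_def numeral_2_eq_2)

lemma cup_cochain_apply: "cup_cochain 1 f g [a, b] = f [a] * g [b]"
  by (simp add: cup_cochain_def)

lemma cup_cocycle:
  assumes f: "f \<in> cocycles G 1" and g: "g \<in> cocycles G 1"
  shows "cup_cochain 1 f g \<in> cocycles G 2"
proof -
  have "cup_cochain 1 f g gs = 0" if out: "\<not> (length gs = 2 \<and> set gs \<subseteq> carrier G)" for gs
  proof (rule ccontr)
    assume "cup_cochain 1 f g gs \<noteq> 0"
    then have "f (take 1 gs) \<noteq> 0" "g (drop 1 gs) \<noteq> 0" by (auto simp: cup_cochain_def)
    then have "length (take 1 gs) = 1 \<and> set (take 1 gs) \<subseteq> carrier G"
      "length (drop 1 gs) = 1 \<and> set (drop 1 gs) \<subseteq> carrier G"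
      using f g unfolding cocycles_def cochains_def by blast+
    moreover have "set gs = set (take 1 gs) \<union> set (drop 1 gs)"
      by (metis append_take_drop_id set_append)
    ultimately show False using out by auto
  qed
  moreover have "coboundary G 2 (cup_cochain 1 f g) gs = 0" for gs
  proof (cases "\<exists>a\<in>carrier G. \<exists>b\<in>carrier G. \<exists>c\<in>carrier G. gs = [a, b, c]")
    case True
    then obtain a b c where abc: "a \<in> carrier G" "b \<in> carrier G" "c \<in> carrier G" "gs = [a, b, c]"
      by blast
    have "f [a \<otimes>\<^bsub>G\<^esub> b] = f [a] + f [b]" "g [b \<otimes>\<^bsub>G\<^esub> c] = g [b] + g [c]"
      using f g abc unfolding cocycles_1_iff by blast+
    then show ?thesis
      using abc by (simp add: coboundary_2_apply cup_cochain_apply algebra_simps del: One_nat_def)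
  qed (rule coboundary_2_outside)
  ultimately show ?thesis unfolding cocycles_def cochains_def by blast
qed

text \<open>
  Up to sign, a primitive \<open>h\<close> of \<open>f \<union> g\<close> is a corner entry that completes \<open>(f, g)\<close> to a homomorphism
  into the Heisenberg group; the condition on \<open>h\<close> is multiplicativity in the corner.
\<close>
lemma cup_coboundary_iff:
  fixes f g :: "'g list \<Rightarrow> 'f::field"
  assumes f: "f \<in> cocycles G 1" and g: "g \<in> cocycles G 1"
    and closed: "\<And>a b. a \<in> carrier G \<Longrightarrow> b \<in> carrier G \<Longrightarrow> a \<otimes>\<^bsub>G\<^esub> b \<in> carrier G"
  shows "cup_cochain 1 f g \<in> coboundaries G 2 \<longleftrightarrow>
    (\<exists>h. \<forall>a\<in>carrier G. \<forall>b\<in>carrier G. h (a \<otimes>\<^bsub>G\<^esub> b) = h a + h b - f [a] * g [b])" (is "?L \<longleftrightarrow> ?R")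
proof
  assume ?L
  then obtain k where k: "cup_cochain 1 f g = coboundary G 1 k"
    unfolding coboundaries_2 by blast
  have "k [a \<otimes>\<^bsub>G\<^esub> b] = k [a] + k [b] - f [a] * g [b]" if "a \<in> carrier G" "b \<in> carrier G" for a b
    using coboundary_1_apply[OF that, of k] cup_cochain_apply[of f g a b] k
    by (simp add: algebra_simps)
  then show ?R by (intro exI[of _ "\<lambda>a. k [a]"]) blast
next
  assume ?R
  then obtain h where h: "\<And>a b. a \<in> carrier G \<Longrightarrow> b \<in> carrier G \<Longrightarrow>
      h (a \<otimes>\<^bsub>G\<^esub> b) = h a + h b - f [a] * g [b]" by blast
  define k where "k = (\<lambda>gs. if length gs = 1 \<and> set gs \<subseteq> carrier G then h (hd gs) else 0)"
  have k1: "k \<in> cochains G 1" by (auto simp: k_def cochains_def)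
  have k2: "coboundary G 1 k = cup_cochain 1 f g"
  proof
    fix gs show "coboundary G 1 k gs = cup_cochain 1 f g gs"
    proof (cases "\<exists>a\<in>carrier G. \<exists>b\<in>carrier G. gs = [a, b]")
      case True
      then obtain a b where ab: "a \<in> carrier G" "b \<in> carrier G" "gs = [a, b]" by blast
      then show ?thesis
        using h closed
        by (simp add: coboundary_1_apply cup_cochain_apply k_def del: One_nat_def)
    next
      case False
      then have "\<not> (length gs = 2 \<and> set gs \<subseteq> carrier G)" by (auto simp: length_2_iff)
      then have "cup_cochain 1 f g gs = 0"
        using cup_cocycle[OF f g] unfolding cocycles_def cochains_def by blast
      then show ?thesis using coboundary_1_outside[OF False] by simp
    qed
  qed
  show ?L unfolding coboundaries_2 k2[symmetric] using k1 by (rule imageI)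
qed

section \<open>Isomorphisms of cup product triples\<close>

text \<open>
  Since there are no nonzero coboundaries in degree one, a class in \<open>H\<^sup>1\<close> is a singleton, and an
  isomorphism of triples induces a map of cocycles. Of the pairing only the relation
  \<open>f \<union> g = 0\<close> is retained, which makes the map on \<open>H\<^sup>2\<close> disappear from the data.
\<close>
definition cup_compatible ::
    "('g, 'm) monoid_scheme \<Rightarrow> ('h, 'n) monoid_scheme \<Rightarrow>
     (('g list \<Rightarrow> 'f::field) \<Rightarrow> 'h list \<Rightarrow> 'f) \<Rightarrow> bool" where
  "cup_compatible G H \<Phi> \<longleftrightarrow>
     bij_betw \<Phi> (cocycles G 1) (cocycles H 1) \<and>
     (\<forall>f\<in>cocycles G 1. \<forall>g\<in>cocycles G 1. \<Phi> (\<lambda>gs. f gs + g gs) = (\<lambda>gs. \<Phi> f gs + \<Phi> g gs)) \<and>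
     (\<forall>c. \<forall>f\<in>cocycles G 1. \<Phi> (\<lambda>gs. c * f gs) = (\<lambda>gs. c * \<Phi> f gs)) \<and>
     (\<forall>f\<in>cocycles G 1. \<forall>g\<in>cocycles G 1.
        cup_cochain 1 f g \<in> coboundaries G 2 \<longleftrightarrow> cup_cochain 1 (\<Phi> f) (\<Phi> g) \<in> coboundaries H 2)"

lemma cocycles_1_add:
  "f \<in> cocycles G 1 \<Longrightarrow> g \<in> cocycles G 1 \<Longrightarrow> (\<lambda>gs. f gs + g gs) \<in> cocycles G 1"
  unfolding cocycles_1_iff by (auto simp: cochains_def)

lemma cocycles_1_scale: "f \<in> cocycles G 1 \<Longrightarrow> (\<lambda>gs. c * f gs) \<in> cocycles G 1"
  unfolding cocycles_1_iff by (auto simp: cochains_def algebra_simps)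

lemma cocycles_1_zero: "(\<lambda>_. 0) \<in> cocycles G 1"
  unfolding cocycles_1_iff by (auto simp: cochains_def)

lemma cocycles_1_sum:
  assumes "finite A" "\<And>v. v \<in> A \<Longrightarrow> F v \<in> cocycles G 1"
  shows "(\<lambda>gs. \<Sum>v\<in>A. c v * F v gs) \<in> cocycles G 1"
  using assms
proof (induction A rule: finite_induct)
  case empty
  then show ?case using cocycles_1_zero by simp
next
  case (insert v A)
  have "F v \<in> cocycles G 1" "(\<lambda>gs. \<Sum>v\<in>A. c v * F v gs) \<in> cocycles G 1"
    using insert by auto
  from cocycles_1_add[OF cocycles_1_scale[OF this(1), of "c v"] this(2)]
  show ?case using insert.hyps by simp
qed

lemma cup_compatible_inverse:
  assumes "cup_compatible G H \<Phi>"
  shows "cup_compatible H G (inv_into (cocycles G 1) \<Phi>)"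
proof -
  let ?Z = "cocycles G 1" and ?Z' = "cocycles H 1"
  define \<Psi> where "\<Psi> = inv_into ?Z \<Phi>"
  have bij: "bij_betw \<Phi> ?Z ?Z'"
    and add: "\<And>f g. f \<in> ?Z \<Longrightarrow> g \<in> ?Z \<Longrightarrow> \<Phi> (\<lambda>gs. f gs + g gs) = (\<lambda>gs. \<Phi> f gs + \<Phi> g gs)"
    and scale: "\<And>c f. f \<in> ?Z \<Longrightarrow> \<Phi> (\<lambda>gs. c * f gs) = (\<lambda>gs. c * \<Phi> f gs)"
    and cup: "\<And>f g. f \<in> ?Z \<Longrightarrow> g \<in> ?Z \<Longrightarrow>
      cup_cochain 1 f g \<in> coboundaries G 2 \<longleftrightarrow> cup_cochain 1 (\<Phi> f) (\<Phi> g) \<in> coboundaries H 2"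
    using assms unfolding cup_compatible_def by blast+
  have in_Z: "\<Psi> f \<in> ?Z" if "f \<in> ?Z'" for f
    using bij that unfolding \<Psi>_def by (metis bij_betw_imp_surj_on inv_into_into)
  have right: "\<Phi> (\<Psi> f) = f" if "f \<in> ?Z'" for f
    using bij that unfolding \<Psi>_def by (rule bij_betw_inv_into_right)
  have left: "\<Psi> (\<Phi> f) = f" if "f \<in> ?Z" for f
    using bij that unfolding \<Psi>_def by (rule bij_betw_inv_into_left)
  have "\<Psi> (\<lambda>gs. f gs + g gs) = (\<lambda>gs. \<Psi> f gs + \<Psi> g gs)" if fg: "f \<in> ?Z'" "g \<in> ?Z'" for f g
    using left[OF cocycles_1_add[OF in_Z in_Z], OF fg] fg by (simp add: add in_Z right del: One_nat_def)
  moreover have "\<Psi> (\<lambda>gs. c * f gs) = (\<lambda>gs. c * \<Psi> f gs)" if f: "f \<in> ?Z'" for c f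
    using left[OF cocycles_1_scale[OF in_Z], OF f, of c] f by (simp add: scale in_Z right del: One_nat_def)
  moreover have "cup_cochain 1 f g \<in> coboundaries H 2 \<longleftrightarrow> cup_cochain 1 (\<Psi> f) (\<Psi> g) \<in> coboundaries G 2"
    if "f \<in> ?Z'" "g \<in> ?Z'" for f g
    using cup[OF in_Z in_Z, OF that] that by (simp add: right del: One_nat_def)
  moreover have "bij_betw \<Psi> ?Z' ?Z" unfolding \<Psi>_def by (rule bij_betw_inv_into[OF bij])
  ultimately show ?thesis unfolding cup_compatible_def \<Psi>_def by blast
qed

lemma carrier_cohomology_1: "carrier (cohomology G 1) = (\<lambda>f. {f}) ` cocycles G 1"
  by (simp add: carrier_cohomology cohomology_class_1 del: One_nat_def)

lemma add_cohomology_1: "{f} \<oplus>\<^bsub>cohomology G 1\<^esub> {g} = {\<lambda>gs. f gs + g gs}"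
  by (simp add: cohomology_def set_add_def set_mult_def cocycle_space_def)

lemma smult_cohomology_1: "c \<odot>\<^bsub>cohomology G 1\<^esub> {f} = {\<lambda>gs. c * f gs}"
  using cohomology_class_1[of G "\<lambda>gs. c * f gs"]
  by (simp add: cohomology_def cocycle_space_def)

lemma triple_isomorphic_cup_compatible:
  assumes "triple_isomorphic (cup_triple TYPE('f::field) G) (cup_triple TYPE('f) H)"
  shows "\<exists>\<Phi> :: ('g list \<Rightarrow> 'f) \<Rightarrow> 'h list \<Rightarrow> 'f. cup_compatible G H \<Phi>"
proof -
  obtain \<phi> :: "('g list \<Rightarrow> 'f) set \<Rightarrow> ('h list \<Rightarrow> 'f) set"
    and \<psi> :: "('g list \<Rightarrow> 'f) set \<Rightarrow> ('h list \<Rightarrow> 'f) set"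
    where \<phi>: "linear_iso (cohomology G 1) (cohomology H 1) \<phi>"
    and \<psi>: "linear_iso (cohomology G 2) (cohomology H 2) \<psi>"
    and q: "\<And>x y. x \<in> carrier (cohomology G 1) \<Longrightarrow> y \<in> carrier (cohomology G 1) \<Longrightarrow>
      cup H 1 1 (\<phi> x) (\<phi> y) = \<psi> (cup G 1 1 x y)"
    using assms unfolding cup_triple_def triple_isomorphic.simps by blast
  let ?Z = "cocycles G 1 :: ('g list \<Rightarrow> 'f) set" and ?Z' = "cocycles H 1 :: ('h list \<Rightarrow> 'f) set"
  define \<Phi> where "\<Phi> f = the_elem (\<phi> {f})" for f
  have bij\<phi>: "bij_betw \<phi> ((\<lambda>f. {f}) ` ?Z) ((\<lambda>f. {f}) ` ?Z')"
    and add\<phi>: "\<And>x y. x \<in> (\<lambda>f. {f}) ` ?Z \<Longrightarrow> y \<in> (\<lambda>f. {f}) ` ?Z \<Longrightarrow>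
      \<phi> (x \<oplus>\<^bsub>cohomology G 1\<^esub> y) = \<phi> x \<oplus>\<^bsub>cohomology H 1\<^esub> \<phi> y"
    and smult\<phi>: "\<And>c x. x \<in> (\<lambda>f. {f}) ` ?Z \<Longrightarrow>
      \<phi> (c \<odot>\<^bsub>cohomology G 1\<^esub> x) = c \<odot>\<^bsub>cohomology H 1\<^esub> \<phi> x"
    using \<phi> unfolding linear_iso_def carrier_cohomology_1 by blast+
  have inj\<psi>: "inj_on \<psi> (carrier (cohomology G 2))"
    and add\<psi>: "\<And>x y. x \<in> carrier (cohomology G 2) \<Longrightarrow> y \<in> carrier (cohomology G 2) \<Longrightarrow>
      \<psi> (x \<oplus>\<^bsub>cohomology G 2\<^esub> y) = \<psi> x \<oplus>\<^bsub>cohomology H 2\<^esub> \<psi> y"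
    using \<psi> unfolding linear_iso_def bij_betw_def by blast+
  have \<Phi>: "\<phi> {f} = {\<Phi> f} \<and> \<Phi> f \<in> ?Z'" if "f \<in> ?Z" for f
  proof -
    have "\<phi> {f} \<in> (\<lambda>f. {f}) ` ?Z'" using bij_betwE[OF bij\<phi>] that by blast
    then obtain g where "g \<in> ?Z'" "\<phi> {f} = {g}" by blast
    then show ?thesis by (simp only: \<Phi>_def the_elem_eq simp_thms)
  qed
  have "bij_betw \<Phi> ?Z ?Z'"
  proof (rule bij_betw_imageI)
    show "inj_on \<Phi> ?Z"
    proof (rule inj_onI)
      fix f g assume "f \<in> ?Z" "g \<in> ?Z" "\<Phi> f = \<Phi> g"
      then have "\<phi> {f} = \<phi> {g}" using \<Phi>[of f] \<Phi>[of g] by metis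
      then have "{f} = {g}"
        using \<open>f \<in> ?Z\<close> \<open>g \<in> ?Z\<close>
        by (intro inj_onD[OF bij_betw_imp_inj_on[OF bij\<phi>]] imageI)
      then show "f = g" by simp
    qed
    show "\<Phi> ` ?Z = ?Z'"
    proof
      show "?Z' \<subseteq> \<Phi> ` ?Z"
      proof
        fix g assume "g \<in> ?Z'"
        then have "{g} \<in> \<phi> ` (\<lambda>f. {f}) ` ?Z" using bij_betw_imp_surj_on[OF bij\<phi>] by blast
        then obtain f where f: "f \<in> ?Z" "\<phi> {f} = {g}" by blast
        then have "g = \<Phi> f" by (simp add: \<Phi>_def)
        then show "g \<in> \<Phi> ` ?Z" using f(1) by (rule image_eqI)
      qed
    next
      show "\<Phi> ` ?Z \<subseteq> ?Z'" using \<Phi> by (intro image_subsetI) (rule conjunct2)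
    qed
  qed
  moreover have "\<Phi> (\<lambda>gs. f gs + g gs) = (\<lambda>gs. \<Phi> f gs + \<Phi> g gs)" if fg: "f \<in> ?Z" "g \<in> ?Z" for f g
  proof -
    have "\<phi> ({f} \<oplus>\<^bsub>cohomology G 1\<^esub> {g}) = \<phi> {f} \<oplus>\<^bsub>cohomology H 1\<^esub> \<phi> {g}"
      using fg by (intro add\<phi> imageI)
    then have "{\<Phi> (\<lambda>gs. f gs + g gs)} = {\<lambda>gs. \<Phi> f gs + \<Phi> g gs}"
      using \<Phi>[OF fg(1)] \<Phi>[OF fg(2)] \<Phi>[OF cocycles_1_add[OF fg]] add_cohomology_1 by metis
    then show ?thesis by simp
  qed
  moreover have "\<Phi> (\<lambda>gs. c * f gs) = (\<lambda>gs. c * \<Phi> f gs)" if f: "f \<in> ?Z" for c f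
  proof -
    have "\<phi> (c \<odot>\<^bsub>cohomology G 1\<^esub> {f}) = c \<odot>\<^bsub>cohomology H 1\<^esub> \<phi> {f}"
      using f by (intro smult\<phi> imageI)
    then have "{\<Phi> (\<lambda>gs. c * f gs)} = {\<lambda>gs. c * \<Phi> f gs}"
      using \<Phi>[OF f] \<Phi>[OF cocycles_1_scale[OF f]] smult_cohomology_1 by metis
    then show ?thesis by simp
  qed
  moreover have "cup_cochain 1 f g \<in> coboundaries G 2 \<longleftrightarrow> cup_cochain 1 (\<Phi> f) (\<Phi> g) \<in> coboundaries H 2"
    if fg: "f \<in> ?Z" "g \<in> ?Z" for f g
  proof -
    let ?A = "cohomology_class G 2 (cup_cochain 1 f g)"
    let ?A' = "cohomology_class H 2 (cup_cochain 1 (\<Phi> f) (\<Phi> g))"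
    let ?k = "cup_cochain 1 f g"
    have kZ: "?k \<in> cocycles G 2" using fg by (rule cup_cocycle)
    \<comment> \<open>Injectivity of \<open>\<psi>\<close> is used at the double of the class, so the double of the cocycle must be
      seen to be a cocycle; it is the cup product of \<open>f + f\<close> and \<open>g\<close>.\<close>
    have dbl: "?A \<oplus>\<^bsub>cohomology G 2\<^esub> ?A \<in> carrier (cohomology G 2)"
    proof -
      have "(\<lambda>gs. ?k gs + ?k gs) = (\<lambda>gs. cup_cochain 1 (\<lambda>gs. f gs + f gs) g gs)"
        by (simp add: cup_cochain_def algebra_simps)
      then have "(\<lambda>gs. ?k gs + ?k gs) \<in> cocycles G 2"
        using cup_cocycle[OF cocycles_1_add[OF fg(1) fg(1)] fg(2)] by simp
      then show ?thesis unfolding add_class_2 carrier_cohomology by (rule imageI)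
    qed
    have A: "?A \<in> carrier (cohomology G 2)" using kZ unfolding carrier_cohomology by (rule imageI)
    have \<psi>A: "\<psi> ?A = ?A'"
    proof -
      have "{f} \<in> carrier (cohomology G 1)" "{g} \<in> carrier (cohomology G 1)"
        unfolding carrier_cohomology_1 using fg by (blast intro: imageI)+
      from q[OF this] show ?thesis using \<Phi> fg by (simp add: cup_1_1 del: One_nat_def)
    qed
    have "?k \<in> coboundaries G 2 \<longleftrightarrow> ?A \<oplus>\<^bsub>cohomology G 2\<^esub> ?A = ?A"
      by (rule class_2_idem_iff[symmetric])
    also have "\<dots> \<longleftrightarrow> \<psi> (?A \<oplus>\<^bsub>cohomology G 2\<^esub> ?A) = \<psi> ?A"
      by (rule inj_on_eq_iff[OF inj\<psi> dbl A, symmetric])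
    also have "\<psi> (?A \<oplus>\<^bsub>cohomology G 2\<^esub> ?A) = \<psi> ?A \<oplus>\<^bsub>cohomology H 2\<^esub> \<psi> ?A"
      by (rule add\<psi>[OF A A])
    also have "(\<psi> ?A \<oplus>\<^bsub>cohomology H 2\<^esub> \<psi> ?A = \<psi> ?A) \<longleftrightarrow>
        cup_cochain 1 (\<Phi> f) (\<Phi> g) \<in> coboundaries H 2"
      unfolding \<psi>A by (rule class_2_idem_iff)
    finally show ?thesis .
  qed
  ultimately show ?thesis unfolding cup_compatible_def by blast
qed

section \<open>Cohomology of right-angled Artin groups\<close>

locale artin =
  fixes V :: "'v set" and E :: "'v set set"
  assumes graph: "simplicial_graph V E"
begin

abbreviation "relators \<equiv>
  {[(v, True), (w, True), (v, False), (w, False)] |v w. {v, w} \<in> E}"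

sublocale presentation V relators
  by unfold_locales (use simplicial_graph_edge_vertex[OF graph] in auto)

lemma RAAG_eq: "RAAG V E = presented_group V relators"
  by (simp add: RAAG_def)

definition gen :: "'v \<Rightarrow> 'v word set" where
  "gen v = cls [(v, True)]"

lemma gen_in_carrier: "v \<in> V \<Longrightarrow> gen v \<in> carrier (RAAG V E)"
  unfolding gen_def RAAG_eq by (rule cls_in_carrier) simp

lemma gen_commute:
  assumes "{v, w} \<in> E"
  shows "gen v \<otimes>\<^bsub>RAAG V E\<^esub> gen w = gen w \<otimes>\<^bsub>RAAG V E\<^esub> gen v"
proof -
  let ?R = "pres_rel V relators"
  have vw: "v \<in> V" "w \<in> V" using simplicial_graph_edge_vertex[OF graph assms] by auto
  have "[(v, True), (w, True), (v, False), (w, False)] \<in> relators" using assms by blast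
  then have "([] @ [(v, True), (w, True), (v, False), (w, False)] @ [(w, True), (v, True)],
      [] @ [(w, True), (v, True)]) \<in> ?R"
    using vw by (intro pres_rel.relator) auto
  moreover have "([(v, True), (w, True), (v, False)] @ [(w, False), (w, \<not> False)] @ [(v, True)],
      [(v, True), (w, True), (v, False)] @ [(v, True)]) \<in> ?R"
    using vw by (intro pres_rel.cancel) auto
  moreover have "([(v, True), (w, True)] @ [(v, False), (v, \<not> False)] @ [],
      [(v, True), (w, True)] @ []) \<in> ?R"
    using vw by (intro pres_rel.cancel) auto
  ultimately have "cls [(v, True), (w, True)] = cls [(w, True), (v, True)]"
    by (auto dest!: cls_eqI)
  then show ?thesis using vw unfolding gen_def RAAG_eq by (simp add: mult_cls)
qed

lemma word_value_respects: "(u, v) \<in> pres_rel V relators \<Longrightarrow> word_value x u = word_value x v"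
  by (induction rule: pres_rel.induct) auto

text \<open>
  The images of two adjacent generators in the Heisenberg group commute exactly when
  \<open>x v * y w = x w * y v\<close>.
\<close>
lemma heisenberg_respects:
  assumes comm: "\<And>v w. {v, w} \<in> E \<Longrightarrow> x v * y w = x w * y v"
  shows "(u, u') \<in> pres_rel V relators \<Longrightarrow> heisenberg x y u = heisenberg x y u'"
proof (induction rule: pres_rel.induct)
  case (cancel u v s b)
  then show ?case by (auto simp: heisenberg_append algebra_simps)
next
  case (relator u u' r)
  then obtain v w where r: "r = [(v, True), (w, True), (v, False), (w, False)]" and e: "{v, w} \<in> E"
    by blast
  have "heisenberg x y r = 0" "word_value x r = 0" "word_value y r = 0"
    using comm[OF e] by (auto simp: r algebra_simps)
  then show ?case by (simp add: heisenberg_append)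
qed auto

text \<open>
  The homomorphism to the additive group of the field with prescribed values on the generators.
\<close>
definition exponent_hom :: "('v \<Rightarrow> 'f::field) \<Rightarrow> 'v word set list \<Rightarrow> 'f" where
  "exponent_hom x = (\<lambda>gs. if length gs = 1 \<and> set gs \<subseteq> carrier (RAAG V E)
     then descend (word_value x) (hd gs) else 0)"

lemma exponent_hom_cls: "u \<in> words V \<Longrightarrow> exponent_hom x [cls u] = word_value x u"
  using descend_cls[of "word_value x" u, OF word_value_respects] cls_in_carrier[of u]
  by (simp add: exponent_hom_def RAAG_eq)

lemma exponent_hom_gen: "v \<in> V \<Longrightarrow> exponent_hom x [gen v] = x v"
  unfolding gen_def by (subst exponent_hom_cls) auto

lemma exponent_hom_cocycle: "exponent_hom x \<in> cocycles (RAAG V E) 1"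
  unfolding cocycles_1_iff
proof (intro conjI ballI)
  show "exponent_hom x \<in> cochains (RAAG V E) 1" by (auto simp: exponent_hom_def cochains_def)
  fix a b assume "a \<in> carrier (RAAG V E)" "b \<in> carrier (RAAG V E)"
  then obtain u v where "u \<in> words V" "v \<in> words V" "a = cls u" "b = cls v"
    unfolding RAAG_eq carrier_presented by blast
  then show "exponent_hom x [a \<otimes>\<^bsub>RAAG V E\<^esub> b] = exponent_hom x [a] + exponent_hom x [b]"
    unfolding RAAG_eq by (simp add: mult_cls exponent_hom_cls)
qed

lemma cocycle_eq_exponent_hom:
  fixes f :: "'v word set list \<Rightarrow> 'f::field"
  assumes f: "f \<in> cocycles (RAAG V E) 1"
  shows "f = exponent_hom (\<lambda>v. f [gen v])"
proof
  fix gs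
  have hom: "f [cls (u @ v)] = f [cls u] + f [cls v]" if "u \<in> words V" "v \<in> words V" for u v
  proof -
    have "f [cls u \<otimes>\<^bsub>RAAG V E\<^esub> cls v] = f [cls u] + f [cls v]"
      using f that cls_in_carrier unfolding cocycles_1_iff RAAG_eq by blast
    then show ?thesis using that unfolding RAAG_eq by (simp add: mult_cls)
  qed
  have nil: "f [cls []] = 0" using hom[of "[]" "[]"] unfolding append_Nil add_cancel_right_right by blast
  have letter: "f [cls [l]] = letter_value (\<lambda>v. f [gen v]) l" if l: "l \<in> V \<times> UNIV" for l
  proof -
    obtain s b where sb: "l = (s, b)" "s \<in> V" using l by auto
    have "([] @ [(s, True), (s, \<not> True)] @ [], [] @ []) \<in> pres_rel V relators"
      using sb by (intro pres_rel.cancel) auto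
    then have "cls ([(s, True)] @ [(s, False)]) = cls []" by (auto dest: cls_eqI)
    then have "f [cls [(s, True)]] + f [cls [(s, False)]] = 0"
      using hom[of "[(s, True)]" "[(s, False)]"] nil sb by simp
    then show ?thesis using sb by (cases b) (auto simp: gen_def add_eq_0_iff2 add_eq_0_iff)
  qed
  have "f [cls u] = word_value (\<lambda>v. f [gen v]) u" if "u \<in> words V" for u
    using that
  proof (induction u)
    case Nil
    then show ?case by (simp add: nil)
  next
    case (Cons l u)
    then have "l \<in> V \<times> UNIV" "u \<in> words V" by auto
    then show ?case using hom[of "[l]" u] letter[of l] Cons.IH by simp
  qed
  then have word: "f [cls u] = exponent_hom (\<lambda>v. f [gen v]) [cls u]" if "u \<in> words V" for u
    using that by (simp add: exponent_hom_cls)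
  show "f gs = exponent_hom (\<lambda>v. f [gen v]) gs"
  proof (cases "length gs = 1 \<and> set gs \<subseteq> carrier (RAAG V E)")
    case True
    then obtain g where "gs = [g]" "g \<in> carrier (RAAG V E)" by (auto simp: length_Suc_conv)
    then obtain u where "u \<in> words V" "gs = [cls u]" unfolding RAAG_eq carrier_presented by blast
    then show ?thesis using word by simp
  next
    case False
    moreover have "f \<in> cochains (RAAG V E) 1" using f by (simp add: cocycles_def)
    ultimately show ?thesis unfolding cochains_def exponent_hom_def by auto
  qed
qed

lemma cocycle_cls:
  assumes "f \<in> cocycles (RAAG V E) 1" "u \<in> words V"
  shows "f [cls u] = word_value (\<lambda>v. f [gen v]) u"
  by (rule HOL.trans[OF fun_cong[OF cocycle_eq_exponent_hom[OF assms(1)]] exponent_hom_cls[OF assms(2)]])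

text \<open>
  If \<open>f \<union> g\<close> is the coboundary of \<open>h\<close>, comparing \<open>h\<close> at the equal elements \<open>gen v \<otimes> gen w\<close> and
  \<open>gen w \<otimes> gen v\<close> gives the equation at an edge. Conversely the equations at the edges let the
  Heisenberg representation of words descend to the group, and its corner entry is a primitive.
\<close>
lemma cup_zero_iff:
  fixes f g :: "'v word set list \<Rightarrow> 'f::field"
  assumes f: "f \<in> cocycles (RAAG V E) 1" and g: "g \<in> cocycles (RAAG V E) 1"
  shows "cup_cochain 1 f g \<in> coboundaries (RAAG V E) 2 \<longleftrightarrow>
    (\<forall>v w. {v, w} \<in> E \<longrightarrow> f [gen v] * g [gen w] = f [gen w] * g [gen v])"
proof -
  have closed: "a \<otimes>\<^bsub>RAAG V E\<^esub> b \<in> carrier (RAAG V E)"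
    if "a \<in> carrier (RAAG V E)" "b \<in> carrier (RAAG V E)" for a b
    using mult_closed that unfolding RAAG_eq .
  have iff: "cup_cochain 1 f g \<in> coboundaries (RAAG V E) 2 \<longleftrightarrow>
      (\<exists>h. \<forall>a\<in>carrier (RAAG V E). \<forall>b\<in>carrier (RAAG V E).
        h (a \<otimes>\<^bsub>RAAG V E\<^esub> b) = h a + h b - f [a] * g [b])"
    by (rule cup_coboundary_iff[OF f g closed])
  show ?thesis
    unfolding iff
  proof (intro iffI allI impI)
    fix v w
    assume e: "{v, w} \<in> E"
    assume "\<exists>h. \<forall>a\<in>carrier (RAAG V E). \<forall>b\<in>carrier (RAAG V E).
      h (a \<otimes>\<^bsub>RAAG V E\<^esub> b) = h a + h b - f [a] * g [b]"
    then obtain h where h: "\<And>a b. a \<in> carrier (RAAG V E) \<Longrightarrow> b \<in> carrier (RAAG V E) \<Longrightarrow>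
      h (a \<otimes>\<^bsub>RAAG V E\<^esub> b) = h a + h b - f [a] * g [b]" by blast
    have vw: "gen v \<in> carrier (RAAG V E)" "gen w \<in> carrier (RAAG V E)"
      using simplicial_graph_edge_vertex[OF graph e] gen_in_carrier by blast+
    have "h (gen v) + h (gen w) - f [gen v] * g [gen w] =
        h (gen w) + h (gen v) - f [gen w] * g [gen v]"
      using h[OF vw] h[OF vw(2,1)] gen_commute[OF e] by simp
    then show "f [gen v] * g [gen w] = f [gen w] * g [gen v]" by (simp add: algebra_simps)
  next
    let ?x = "\<lambda>v. f [gen v]" and ?y = "\<lambda>v. g [gen v]"
    assume "\<forall>v w. {v, w} \<in> E \<longrightarrow> f [gen v] * g [gen w] = f [gen w] * g [gen v]"
    then have resp: "heisenberg ?x ?y u = heisenberg ?x ?y u'"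
      if "(u, u') \<in> pres_rel V relators" for u u'
      using heisenberg_respects[of ?x ?y, OF _ that] by blast
    define h where "h = descend (heisenberg ?x ?y)"
    have "h (a \<otimes>\<^bsub>RAAG V E\<^esub> b) = h a + h b - f [a] * g [b]"
      if "a \<in> carrier (RAAG V E)" "b \<in> carrier (RAAG V E)" for a b
    proof -
      obtain u v where uv: "u \<in> words V" "v \<in> words V" "a = cls u" "b = cls v"
        using \<open>a \<in> _\<close> \<open>b \<in> _\<close> unfolding RAAG_eq carrier_presented by blast
      have h_cls: "h (cls u) = heisenberg ?x ?y u" if "u \<in> words V" for u
        unfolding h_def using resp that by (rule descend_cls)
      have fg: "f [a] = word_value ?x u" "g [b] = word_value ?y v"
        unfolding uv by (rule cocycle_cls[OF f uv(1)], rule cocycle_cls[OF g uv(2)])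
      have "a \<otimes>\<^bsub>RAAG V E\<^esub> b = cls (u @ v)" "u @ v \<in> words V"
        using uv unfolding RAAG_eq by (simp_all add: mult_cls)
      then show ?thesis
        unfolding fg using uv by (simp add: h_cls heisenberg_append)
    qed
    then show "\<exists>h. \<forall>a\<in>carrier (RAAG V E). \<forall>b\<in>carrier (RAAG V E).
      h (a \<otimes>\<^bsub>RAAG V E\<^esub> b) = h a + h b - f [a] * g [b]" by blast
  qed
qed

text \<open>
  The basis of \<open>H\<^sup>1\<close> dual to the generators.
\<close>
abbreviation dual :: "'v \<Rightarrow> 'v word set list \<Rightarrow> 'f::field" where
  "dual v \<equiv> exponent_hom (\<lambda>w. if w = v then 1 else 0)"

lemma cocycle_dual_expansion:
  fixes f :: "'v word set list \<Rightarrow> 'f::field"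
  assumes f: "f \<in> cocycles (RAAG V E) 1"
  shows "f = (\<lambda>gs. \<Sum>v\<in>V. f [gen v] * dual v gs)"
proof -
  have fin: "finite V" using graph by (simp add: simplicial_graph_def)
  let ?s = "\<lambda>gs. \<Sum>v\<in>V. f [gen v] * dual v gs"
  have "?s \<in> cocycles (RAAG V E) 1"
    using fin exponent_hom_cocycle by (rule cocycles_1_sum)
  then have s: "?s = exponent_hom (\<lambda>w. ?s [gen w])" by (rule cocycle_eq_exponent_hom)
  have eq: "?s [gen w] = f [gen w]" if "w \<in> V" for w
    using that fin by (simp add: exponent_hom_gen if_distrib cong: if_cong)
  have val: "word_value (\<lambda>w. ?s [gen w]) u = word_value (\<lambda>w. f [gen w]) u" if "u \<in> words V" for u
    using that by (induction u) (auto simp: eq)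
  have "?s gs = f gs" for gs
  proof (cases "length gs = 1 \<and> set gs \<subseteq> carrier (RAAG V E)")
    case True
    then obtain g where "gs = [g]" "g \<in> carrier (RAAG V E)" by (auto simp: length_Suc_conv)
    then obtain u where u: "u \<in> words V" "gs = [cls u]" unfolding RAAG_eq carrier_presented by blast
    then show ?thesis
      using fun_cong[OF s, of gs] fun_cong[OF cocycle_eq_exponent_hom[OF f], of gs] val
      by (simp add: exponent_hom_cls)
  next
    case False
    moreover have "f \<in> cochains (RAAG V E) 1" using f by (simp add: cocycles_def)
    ultimately have "f gs = 0" unfolding cochains_def by auto
    moreover have "dual v gs = (0 :: 'f)" for v using False unfolding exponent_hom_def by (rule if_not_P)
    ultimately show ?thesis by simp
  qed
  then show ?thesis by (intro ext) simp
qed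

end

lemma cup_compatible_sum:
  fixes \<Phi> :: "('g list \<Rightarrow> 'f::field) \<Rightarrow> 'h list \<Rightarrow> 'f"
  assumes \<Phi>: "cup_compatible G H \<Phi>" and "finite A" "\<And>v. v \<in> A \<Longrightarrow> F v \<in> cocycles G 1"
  shows "\<Phi> (\<lambda>gs. \<Sum>v\<in>A. c v * F v gs) = (\<lambda>gs. \<Sum>v\<in>A. c v * \<Phi> (F v) gs)"
proof -
  have add: "\<And>f g. f \<in> cocycles G 1 \<Longrightarrow> g \<in> cocycles G 1 \<Longrightarrow> \<Phi> (\<lambda>gs. f gs + g gs) = (\<lambda>gs. \<Phi> f gs + \<Phi> g gs)"
    and scale: "\<And>c f. f \<in> cocycles G 1 \<Longrightarrow> \<Phi> (\<lambda>gs. c * f gs) = (\<lambda>gs. c * \<Phi> f gs)"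
    using \<Phi> unfolding cup_compatible_def by blast+
  show ?thesis
    using assms(2,3)
  proof (induction A rule: finite_induct)
    case empty
    then show ?case using scale[OF cocycles_1_zero, of 0] by simp
  next
    case (insert v A)
    have v: "F v \<in> cocycles G 1" using insert.prems by simp
    have rest: "(\<lambda>gs. \<Sum>v\<in>A. c v * F v gs) \<in> cocycles G 1"
      using insert.hyps(1) insert.prems by (intro cocycles_1_sum) auto
    show ?case
      using insert.hyps add[OF cocycles_1_scale[OF v] rest, of "c v"] scale[OF v]
        insert.IH insert.prems
      by simp
  qed
qed

section \<open>Matrices of an isomorphism of triples\<close>

text \<open>
  The situation is symmetric in the two graphs except for \<open>\<Psi>\<Phi>\<close>, which expresses that \<open>\<Psi>\<close> is a left
  inverse. Interpreting the locale in both directions gives two mutually inverse matrices.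
\<close>
locale cup_compatible_artin = source: artin V E + target: artin V' E'
  for V :: "'v set" and E :: "'v set set" and V' :: "'w set" and E' :: "'w set set" +
  fixes \<Phi> :: "('v word set list \<Rightarrow> 'f::field) \<Rightarrow> 'w word set list \<Rightarrow> 'f"
    and \<Psi> :: "('w word set list \<Rightarrow> 'f) \<Rightarrow> 'v word set list \<Rightarrow> 'f"
  assumes \<Phi>: "cup_compatible (RAAG V E) (RAAG V' E') \<Phi>"
    and \<Psi>\<Phi>: "\<And>f. f \<in> cocycles (RAAG V E) 1 \<Longrightarrow> \<Psi> (\<Phi> f) = f"
    and \<Psi>: "cup_compatible (RAAG V' E') (RAAG V E) \<Psi>"
begin

definition matrix :: "'v \<Rightarrow> 'w \<Rightarrow> 'f" where
  "matrix v a = \<Phi> (source.dual v) [target.gen a]"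

definition inverse_matrix :: "'w \<Rightarrow> 'v \<Rightarrow> 'f" where
  "inverse_matrix a v = \<Psi> (target.dual a) [source.gen v]"

lemma matrix_inverse:
  assumes "v \<in> V" "w \<in> V"
  shows "(\<Sum>a\<in>V'. matrix v a * inverse_matrix a w) = (if v = w then 1 else 0)"
proof -
  let ?f = "source.dual v :: 'v word set list \<Rightarrow> 'f"
  have fin: "finite V'" using target.graph by (simp add: simplicial_graph_def)
  have f: "?f \<in> cocycles (RAAG V E) 1" by (rule source.exponent_hom_cocycle)
  then have \<Phi>f: "\<Phi> ?f \<in> cocycles (RAAG V' E') 1"
    using \<Phi> unfolding cup_compatible_def by (blast dest: bij_betwE)
  have "?f = \<Psi> (\<lambda>gs. \<Sum>a\<in>V'. \<Phi> ?f [target.gen a] * target.dual a gs)"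
    using \<Psi>\<Phi>[OF f] target.cocycle_dual_expansion[OF \<Phi>f] by simp
  also have "\<dots> = (\<lambda>gs. \<Sum>a\<in>V'. \<Phi> ?f [target.gen a] * \<Psi> (target.dual a) gs)"
    by (rule cup_compatible_sum[OF \<Psi> fin]) (rule target.exponent_hom_cocycle)
  finally have "?f [source.gen w] = (\<Sum>a\<in>V'. matrix v a * inverse_matrix a w)"
    unfolding matrix_def inverse_matrix_def by (rule fun_cong)
  then show ?thesis using assms by (cases "v = w") (simp_all add: source.exponent_hom_gen)
qed

text \<open>
  At an edge \<open>{s, t}\<close> the minor of the dual classes of \<open>v\<close> and \<open>w\<close> is nonzero only if
  \<open>{s, t} = {v, w}\<close>, so dual classes of nonadjacent vertices have cup product zero, and so have
  their images.
\<close>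
lemma matrix_minor:
  assumes "v \<in> V" "w \<in> V" "{v, w} \<notin> E" "{a, b} \<in> E'"
  shows "matrix v a * matrix w b = matrix v b * matrix w a"
proof -
  let ?f = "source.dual v :: 'v word set list \<Rightarrow> 'f" and ?g = "source.dual w :: 'v word set list \<Rightarrow> 'f"
  have f: "?f \<in> cocycles (RAAG V E) 1" "?g \<in> cocycles (RAAG V E) 1"
    by (rule source.exponent_hom_cocycle)+
  then have \<Phi>f: "\<Phi> ?f \<in> cocycles (RAAG V' E') 1" "\<Phi> ?g \<in> cocycles (RAAG V' E') 1"
    using \<Phi> unfolding cup_compatible_def by (blast dest: bij_betwE)+
  have "?f [source.gen s] * ?g [source.gen t] = ?f [source.gen t] * ?g [source.gen s]"
    if "{s, t} \<in> E" for s t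
    using that assms(3) simplicial_graph_edge_vertex[OF source.graph that]
    by (auto simp: source.exponent_hom_gen insert_commute)
  then have "cup_cochain 1 ?f ?g \<in> coboundaries (RAAG V E) 2"
    unfolding source.cup_zero_iff[OF f] by blast
  then have "cup_cochain 1 (\<Phi> ?f) (\<Phi> ?g) \<in> coboundaries (RAAG V' E') 2"
    using \<Phi> f unfolding cup_compatible_def by blast
  then show ?thesis
    using assms(4) unfolding target.cup_zero_iff[OF \<Phi>f] matrix_def by blast
qed

end

theorem theorem2p6:
  fixes V :: "'v set" and E :: "'v set set"
    and V' :: "'w set" and E' :: "'w set set"
  assumes "simplicial_graph V E"
    and "simplicial_graph V' E'"
    and "triple_isomorphic
           (cup_triple TYPE('f::field) (RAAG V E)) (cup_triple TYPE('f) (RAAG V' E'))"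
  shows "graph_isomorphic V E V' E'"
proof -
  obtain \<Phi> :: "('v word set list \<Rightarrow> 'f) \<Rightarrow> 'w word set list \<Rightarrow> 'f"
    where \<Phi>: "cup_compatible (RAAG V E) (RAAG V' E') \<Phi>"
    using triple_isomorphic_cup_compatible[OF assms(3)] by blast
  define \<Psi> where "\<Psi> = inv_into (cocycles (RAAG V E) 1) \<Phi>"
  have \<Psi>: "cup_compatible (RAAG V' E') (RAAG V E) \<Psi>"
    unfolding \<Psi>_def by (rule cup_compatible_inverse[OF \<Phi>])
  have bij: "bij_betw \<Phi> (cocycles (RAAG V E) 1) (cocycles (RAAG V' E') 1)"
    using \<Phi> unfolding cup_compatible_def by blast
  interpret fwd: cup_compatible_artin V E V' E' \<Phi> \<Psi>
    using assms(1,2) \<Phi> \<Psi> bij_betw_inv_into_left[OF bij]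
    by unfold_locales (auto simp: \<Psi>_def)
  interpret bwd: cup_compatible_artin V' E' V E \<Psi> \<Phi>
    using assms(1,2) \<Phi> \<Psi> bij_betw_inv_into_right[OF bij]
    by unfold_locales (auto simp: \<Psi>_def)
  have "bwd.matrix = fwd.inverse_matrix" "bwd.inverse_matrix = fwd.matrix"
    by (intro ext; simp add: fwd.matrix_def fwd.inverse_matrix_def
        bwd.matrix_def bwd.inverse_matrix_def)+
  then interpret inverse_graph_matrices V E V' E' fwd.matrix fwd.inverse_matrix
    using assms(1,2) fwd.matrix_inverse bwd.matrix_inverse fwd.matrix_minor bwd.matrix_minor
    by unfold_locales auto
  show ?thesis by (rule graph_isomorphic_of_inverse_matrices)
qed

end
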